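(* There is an absolute constant $C>0$ such that for all integers $n\ge m\ge 1$, writing $u=n/m$, \[ \left|\log\frac{p_{n,m}}{\rho(u)\exp\left(\frac{u\xi(u)}{2m}\right)}\right| \le C\left(\frac{u\log^2(u+1)}{m^2}+\frac{1}{u}\right).\] Moreover, for every $K>0$ there is a constant $C_K>0$ such that for all integers $n\ge m\ge 1$ with $\sqrt{n\log n}\le Km$, \[ p_{n,m}=\rho(u)\exp\left(\frac{u\xi(u)}{2m}\right)\left(1+\theta\right),\qquad |\theta|\le C_K\frac{\log(u+1)}{m}.\]
   Context: For integers $n\ge m\ge 1$, a permutation is $m$-friable if all its cycles have length at most $m$; $p_{n,m}$ denotes the probability that a uniformly random permutation in $S_n$ is $m$-friable, and $u:=n/m$. The Dickman function $\rho:[0,\infty)\to(0,\infty)$ is the continuous function with $\rho(t)=1$ for $t\in[0,1]$ and $t\rho'(t)+\rho(t-1)=0$ for $t>1$. For $u>1$, $\xi(u)$ is the unique positive solution of $e^{\xi}=1+u\xi$, and $\xi(1)=0$. *)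

theory Defs
  imports "HOL-Probability.Probability" "HOL-Combinatorics.Orbits"
begin

text \<open>A cycle of a permutation of \<open>A\<close> is represented by its underlying set, so that its
  length is the cardinality of that set. Fixed points count as cycles of length 1.\<close>

definition friable_on :: "'a set \<Rightarrow> nat \<Rightarrow> ('a \<Rightarrow> 'a) \<Rightarrow> bool" where
  "friable_on A m \<pi> \<longleftrightarrow> (\<forall>c. c \<subseteq> A \<and> cyclic_on \<pi> c \<longrightarrow> card c \<le> m)"

definition friable_prob :: "nat \<Rightarrow> nat \<Rightarrow> real" where
  "friable_prob n m =
     measure_pmf.prob (pmf_of_set {\<pi>. \<pi> permutes {1..n}}) {\<pi>. friable_on {1..n} m \<pi>}"

text \<open>The Dickman function lives on \<open>[0,\<infinity>)\<close>; the value 0 on the negative reals is only a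
  convention that makes it unique as a total function on the reals.\<close>

definition is_dickman :: "(real \<Rightarrow> real) \<Rightarrow> bool" where
  "is_dickman r \<longleftrightarrow>
     (\<forall>t\<ge>0. r t > 0) \<and> continuous_on {0..} r \<and>
     (\<forall>t\<in>{0..1}. r t = 1) \<and>
     (\<forall>t>1. \<exists>D. (r has_real_derivative D) (at t) \<and> t * D + r (t - 1) = 0) \<and>
     (\<forall>t<0. r t = 0)"

definition dickman :: "real \<Rightarrow> real" where
  "dickman = (THE r. is_dickman r)"

text \<open>Only \<open>u \<ge> 1\<close> is meaningful, with \<open>\<xi>(1) = 0\<close>.\<close>

definition xi :: "real \<Rightarrow> real" where
  "xi u = (if u > 1 then (THE x. x > 0 \<and> exp x = 1 + u * x) else 0)"

end

theory Submission
  imports Defs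
begin

text \<open>
  Write \<open>p\<^sub>n = p\<^sub>n\<^sub>,\<^sub>m\<close> and \<open>\<lambda> = - \<rho>' / \<rho>\<close>. Conditioning on the cycle through a given point yields
  \<open>n p\<^sub>n = p\<^sub>n\<^sub>-\<^sub>1 + \<dots> + p\<^sub>n\<^sub>-\<^sub>m\<close> for \<open>n > m\<close>, a discrete version of \<open>u \<rho>(u) = \<integral> \<rho>\<close> over \<open>[u - 1, u]\<close>.
  Both recurrences are monotone, so they can be compared: by the midpoint rule
  \<open>f\<^sub>n = \<rho>((n + 1/2) / (m + 1/2))\<close> is nearly a solution of the discrete one with the same initial
  values, the relative error of each step being of order \<open>(\<lambda> / m)\<^sup>2\<close>. Convexity of \<open>\<rho>\<close> gives
  \<open>p\<^sub>n \<le> (1 + O(1/m)) f\<^sub>n\<close>, and log-concavity gives \<open>p\<^sub>n \<ge> f\<^sub>n exp (- O(u (\<lambda> / m)\<^sup>2))\<close>.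

  Log-concavity of \<open>\<rho>\<close> also locates \<open>\<lambda>\<close>: as \<open>\<lambda>\<close> increases, \<open>u = \<integral>\<^sub>0\<^sup>1 \<rho>(u - t) / \<rho>(u) dt\<close> gives
  \<open>u \<lambda>(u) \<le> e\<^bsup>\<lambda>(u)\<^esup> - 1 \<le> (u + 1) \<lambda>(u)\<close>, that is \<open>\<xi>(u) \<le> \<lambda>(u) \<le> \<xi>(u + 1)\<close>. Integrating \<open>\<lambda>\<close> from
  \<open>(n + 1/2) / (m + 1/2)\<close> to \<open>u = n / m\<close> produces the factor \<open>exp (u \<xi>(u) / (2m))\<close>. The total error is
  \<open>O(u log\<^sup>2(u + 1) / m\<^sup>2 + log(u + 1) / m)\<close>, which implies both claims.
\<close>

section \<open>Elementary inequalities; existence and uniqueness of \<open>xi\<close>\<close>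

lemma sinh_le_mult_cosh:
  fixes z :: real assumes "z \<ge> 0" shows "sinh z \<le> z * cosh z"
proof -
  have "0 * cosh 0 - sinh 0 \<le> z * cosh z - sinh (z::real)"
  proof (rule DERIV_nonneg_imp_nondecreasing[OF assms, where f = "\<lambda>z. z * cosh z - sinh z"])
    fix x :: real assume "0 \<le> x" "x \<le> z"
    have "((\<lambda>z. z * cosh z - sinh z) has_real_derivative x * sinh x) (at x)"
      by (auto intro!: derivative_eq_intros)
    then show "\<exists>y. ((\<lambda>z. z * cosh z - sinh z) has_real_derivative y) (at x) \<and> 0 \<le> y"
      using \<open>0 \<le> x\<close> by auto
  qed
  then show ?thesis by simp
qed

lemma cosh_le_exp_square:
  fixes z :: real assumes "z \<ge> 0" shows "cosh z \<le> exp (z\<^sup>2 / 2)"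
proof -
  let ?f = "\<lambda>z::real. cosh z * exp (- (z\<^sup>2 / 2))"
  have "?f z \<le> ?f 0"
  proof (rule DERIV_nonpos_imp_nonincreasing[OF assms, where f = ?f])
    fix x :: real assume "0 \<le> x" "x \<le> z"
    have "(?f has_real_derivative (sinh x - x * cosh x) * exp (- (x\<^sup>2 / 2))) (at x)"
      by (auto intro!: derivative_eq_intros simp: algebra_simps)
    moreover have "(sinh x - x * cosh x) * exp (- (x\<^sup>2 / 2)) \<le> 0"
      using sinh_le_mult_cosh[OF \<open>0 \<le> x\<close>] by (simp add: mult_le_0_iff)
    ultimately show "\<exists>y. (?f has_real_derivative y) (at x) \<and> y \<le> 0" by blast
  qed
  then show ?thesis by (simp add: exp_minus field_simps)
qed

text \<open>\<open>sinh z / z\<close> is the mean of \<open>exp\<close> over \<open>[-z, z]\<close>.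
  That it exceeds 1 only to second order in \<open>z\<close> is what makes the midpoint rule for
  \<rho> accurate enough later.\<close>

lemma sinh_le_exp_square:
  fixes z :: real assumes "z \<ge> 0" shows "sinh z \<le> z * exp (z\<^sup>2 / 2)"
  using sinh_le_mult_cosh[OF assms] mult_left_mono[OF cosh_le_exp_square[OF assms] assms] by linarith

text \<open>Equivalent to \<open>tanh (x/2) \<le> x/2\<close>; it bounds the logarithmic derivative
  of \<open>(exp x - 1) / x\<close> below by \<open>1/2\<close>.\<close>

lemma exp_two_le_mult_exp_add_one:
  fixes x :: real assumes "x \<ge> 0" shows "2 * (exp x - 1) \<le> x * (exp x + 1)"
proof -
  let ?f = "\<lambda>x::real. x * (exp x + 1) - 2 * (exp x - 1)"
  have "?f 0 \<le> ?f x"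
  proof (rule DERIV_nonneg_imp_nondecreasing[OF assms, where f = ?f])
    fix y :: real assume "0 \<le> y" "y \<le> x"
    have "(?f has_real_derivative (y * exp y + 1 - exp y)) (at y)"
      by (auto intro!: derivative_eq_intros simp: algebra_simps)
    moreover have "1 - y \<le> exp (- y)" using exp_ge_add_one_self[of "-y"] by simp
    then have "(1 - y) * exp y \<le> exp (-y) * exp y" by (intro mult_right_mono) auto
    then have "y * exp y + 1 - exp y \<ge> 0" by (simp add: exp_minus algebra_simps)
    ultimately show "\<exists>z. (?f has_real_derivative z) (at y) \<and> 0 \<le> z" by blast
  qed
  then show ?thesis by simp
qed

lemma ln_exp_quotient_growth:
  fixes x y :: real
  assumes "0 < x" "x \<le> y"
  shows "(y - x) / 2 \<le> ln ((exp y - 1) / y) - ln ((exp x - 1) / x)"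
proof -
  let ?f = "\<lambda>x::real. ln (exp x - 1) - ln x - x / 2"
  have "?f x \<le> ?f y"
  proof (rule DERIV_nonneg_imp_nondecreasing[OF assms(2), where f = ?f])
    fix z :: real assume z: "x \<le> z" "z \<le> y"
    with assms have "z > 0" by simp
    then have e: "exp z > 1" by simp
    have "(?f has_real_derivative (exp z / (exp z - 1) - 1 / z - 1 / 2)) (at z)"
      using \<open>z > 0\<close> e by (auto intro!: derivative_eq_intros)
    moreover have "exp z / (exp z - 1) - 1 / z - 1 / 2 
        = (z * (exp z + 1) - 2 * (exp z - 1)) / (2 * z * (exp z - 1))"
      using \<open>z > 0\<close> e by (simp add: divide_simps) (simp add: algebra_simps)
    moreover have "\<dots> \<ge> 0"
      using exp_two_le_mult_exp_add_one[of z] \<open>z > 0\<close> e by (intro divide_nonneg_nonneg) auto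
    ultimately show "\<exists>d. (?f has_real_derivative d) (at z) \<and> 0 \<le> d"
      by (intro exI[of _ "exp z / (exp z - 1) - 1 / z - 1 / 2"]) simp
  qed
  moreover have "ln ((exp y - 1) / y) = ln (exp y - 1) - ln y"
    using assms by (subst ln_div) auto
  moreover have "ln ((exp x - 1) / x) = ln (exp x - 1) - ln x"
    using assms by (subst ln_div) auto
  ultimately show ?thesis by (simp add: field_simps)
qed

text \<open>Stability of the root of \<open>exp x - 1 = u x\<close> in the slope \<open>u\<close>:
  the logarithm of \<open>(exp x - 1) / x\<close> grows at rate at least \<open>1/2\<close>. Since
  only one-sided inequalities are required, this applies to \<lambda> as well as to
  \<open>xi\<close>; equal slopes give uniqueness of \<open>xi\<close>.\<close>

lemma exp_eq_root_le:
  fixes x y a b :: real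
  assumes "0 < x" "0 < y" "0 < b" "b \<le> a" "b * x \<le> exp x - 1" "exp y - 1 \<le> a * y"
  shows "y \<le> x + 2 * ln (a / b)"
proof (cases "y \<le> x")
  case True
  moreover have "ln (a / b) \<ge> 0" using assms by (intro ln_ge_zero) (auto simp: field_simps)
  ultimately show ?thesis by simp
next
  case False
  have "ln ((exp y - 1) / y) \<le> ln a"
    using assms by (subst ln_le_cancel_iff) (auto simp: field_simps)
  moreover have "ln b \<le> ln ((exp x - 1) / x)"
    using assms by (subst ln_le_cancel_iff) (auto simp: field_simps)
  ultimately show ?thesis
    using ln_exp_quotient_growth[of x y] False assms by (auto simp: ln_div)
qed

lemma xi_props:
  assumes "u > 1"
  shows xi_pos: "xi u > 0" and "exp (xi u) = 1 + u * xi u"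
proof -
  \<comment> \<open>The left end for the intermediate value theorem, positive in order to exclude
    the trivial root 0. The bound \<open>a \<le> 1\<close> permits
    \<open>exp a \<le> 1 + a + a^2\<close>, and \<open>a \<le> u - 1\<close> brings this below
    \<open>1 + u a\<close>.\<close>
  define a where "a = min 1 (u - 1)"
  have a: "0 < a" "a \<le> 1" "a \<le> u - 1" using assms by (auto simp: a_def)
  have "exp a \<le> 1 + a + a\<^sup>2" using exp_bound[of a] a by simp
  also have "\<dots> \<le> 1 + u * a"
    using mult_left_mono[of a "u - 1" a] a by (simp add: power2_eq_square algebra_simps)
  finally have low: "exp a - u * a \<le> 1" by simp
  have "1 + 2 * u + (2 * u)\<^sup>2 / 2 \<le> exp (2 * u)"
    using assms by (intro exp_lower_Taylor_quadratic) auto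
  then have high: "1 \<le> exp (2 * u) - u * (2 * u)"
    using assms by (simp add: power2_eq_square)
  obtain x where "x \<ge> a" "exp x - u * x = 1"
    using IVT'[of "\<lambda>x. exp x - u * x" a 1 "2 * u"] low high a assms
    by (force intro!: continuous_intros)
  then have x: "x > 0" "exp x = 1 + u * x" using a by auto
  have uniq: "y = x" if "y > 0" "exp y = 1 + u * y" for y
    using exp_eq_root_le[of x y u u] exp_eq_root_le[of y x u u] that x assms by auto
  have "xi u = (THE x. x > 0 \<and> exp x = 1 + u * x)" using assms by (simp add: xi_def)
  also have "\<dots> = x" using x uniq by (intro the_equality conjI) blast+
  finally show "xi u > 0" "exp (xi u) = 1 + u * xi u" using x by simp_all
qed

section \<open>The Dickman function\<close>

lemma continuous_on_atLeast:
  fixes f :: "real \<Rightarrow> real"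
  assumes "\<And>b. continuous_on {a..b} f"
  shows "continuous_on {a..} f"
  unfolding continuous_on_eq_continuous_within
proof
  fix x assume "x \<in> {a..}"
  then have "continuous (at x within {a..x + 1}) f"
    using assms[of "x + 1"] by (simp add: continuous_on_eq_continuous_within)
  moreover have "at x within {a..x + 1} = at x within {a..}"
    by (rule at_within_nhd[of x "{..<x+1}"]) auto
  ultimately show "continuous (at x within {a..}) f" by simp
qed

lemma continuous_on_indefinite_integral_atLeast:
  fixes f :: "real \<Rightarrow> real"
  assumes "continuous_on {a..} f"
  shows "continuous_on {a..} (\<lambda>t. integral {a..t} f)"
proof (rule continuous_on_atLeast)
  fix b show "continuous_on {a..b} (\<lambda>t. integral {a..t} f)"
    using assms by (intro indefinite_integral_continuous_1 integrable_continuous_real)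
      (auto intro: continuous_on_subset)
qed

lemma indefinite_integral_has_real_derivative:
  fixes f :: "real \<Rightarrow> real"
  assumes "continuous_on {a..} f" "a < t"
  shows "((\<lambda>t. integral {a..t} f) has_real_derivative f t) (at t)"
proof -
  have "((\<lambda>t. integral {a..t} f) has_real_derivative f t) (at t within {a..t+1})"
    using assms by (intro integral_has_real_derivative) (auto intro: continuous_on_subset)
  moreover have "at t within {a..t+1} = at t"
    using assms by (intro at_within_Icc_at) auto
  ultimately show ?thesis by simp
qed

text \<open>Picard iterates of the integral equation \<open>\<rho>(t) = 1 - \<integral>\<^sub>1\<^sup>t \<rho>(s - 1) / s ds\<close>; they become
  stationary on every bounded interval.\<close>

primrec dickman_iter :: "nat \<Rightarrow> real \<Rightarrow> real" where
  "dickman_iter 0 t = (if t < 0 then 0 else 1)"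
| "dickman_iter (Suc k) t =
    (if t < 0 then 0 else 1 - integral {1..t} (\<lambda>s. dickman_iter k (s - 1) / s))"

lemma integral_atLeastAtMost_eq_0: "b \<le> a \<Longrightarrow> integral {a..b} f = 0" for a b :: real
  by (cases "b = a") auto

lemma continuous_on_shift_div:
  fixes r :: "real \<Rightarrow> real"
  assumes "continuous_on {0..} r"
  shows "continuous_on {1..} (\<lambda>s. r (s - 1) / s)"
  by (intro continuous_intros continuous_on_compose2[OF assms]) auto

lemma continuous_on_dickman_iter: "continuous_on {0..} (dickman_iter k)"
proof (induction k)
  case 0
  have "continuous_on {0..} (\<lambda>t::real. 1 :: real)" by simp
  then show ?case by (rule continuous_on_eq) auto
next
  case (Suc k)
  let ?F = "\<lambda>t. integral {1..t} (\<lambda>s. dickman_iter k (s - 1) / s)"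
  have "continuous_on {0..} (\<lambda>t. 1 - ?F (max 1 t))"
    by (intro continuous_intros continuous_on_compose2[OF
          continuous_on_indefinite_integral_atLeast[OF continuous_on_shift_div[OF Suc]]]) auto
  then show ?case
  proof (rule continuous_on_eq)
    fix t :: real assume "t \<in> {0..}"
    then show "1 - ?F (max 1 t) = dickman_iter (Suc k) t"
      by (cases "t \<le> 1") (auto simp: integral_atLeastAtMost_eq_0 max_def)
  qed
qed

text \<open>The value at \<open>t\<close> involves the previous iterate only up to
  \<open>t - 1\<close>, so each iteration prolongs the interval of stationarity by one.\<close>

lemma dickman_iter_Suc_eq:
  "t \<le> real k + 1 \<Longrightarrow> dickman_iter (Suc k) t = dickman_iter k t"
proof (induction k arbitrary: t)
  case 0
  then show ?case by (simp add: integral_atLeastAtMost_eq_0)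
next
  case (Suc k)
  have "integral {1..t} (\<lambda>s. dickman_iter (Suc k) (s - 1) / s)
      = integral {1..t} (\<lambda>s. dickman_iter k (s - 1) / s)"
    using Suc by (intro integral_cong) (simp del: dickman_iter.simps)
  then show ?case by simp
qed

lemma dickman_iter_eq:
  assumes "t \<le> real k + 1" "k \<le> j"
  shows "dickman_iter j t = dickman_iter k t"
  using assms(2)
proof (induction j rule: dec_induct)
  case (step j)
  then show ?case using dickman_iter_Suc_eq[of t j] assms(1) by simp
qed simp

definition dickman_limit :: "real \<Rightarrow> real" where
  "dickman_limit t = dickman_iter (nat \<lceil>t\<rceil>) t"

lemma dickman_limit_eq_iter:
  assumes "t \<le> real k"
  shows "dickman_limit t = dickman_iter k t"
proof -
  have "dickman_iter k t = dickman_iter (nat \<lceil>t\<rceil>) t"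
    using assms by (intro dickman_iter_eq) linarith+
  then show ?thesis by (simp add: dickman_limit_def)
qed

lemma dickman_limit_integral_eq:
  assumes "t \<ge> 0"
  shows "dickman_limit t = 1 - integral {1..t} (\<lambda>s. dickman_limit (s - 1) / s)"
proof -
  obtain k where k: "t \<le> real k" using real_arch_simple by blast
  have "integral {1..t} (\<lambda>s. dickman_limit (s - 1) / s)
      = integral {1..t} (\<lambda>s. dickman_iter k (s - 1) / s)"
    using k by (intro integral_cong) (simp add: dickman_limit_eq_iter[of _ k])
  then show ?thesis
    using assms k by (simp add: dickman_limit_eq_iter[of t "Suc k"])
qed

lemma continuous_on_dickman_limit: "continuous_on {0..} dickman_limit"
proof (rule continuous_on_atLeast)
  fix b :: real
  obtain k where k: "b \<le> real k" using real_arch_simple by blast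
  have "continuous_on {0..b} (dickman_iter k)"
    using continuous_on_dickman_iter by (rule continuous_on_subset) auto
  then show "continuous_on {0..b} dickman_limit"
    by (rule continuous_on_eq) (use k in \<open>auto simp: dickman_limit_eq_iter[of _ k]\<close>)
qed

lemma dickman_limit_has_derivative:
  assumes "t > 1"
  shows "(dickman_limit has_real_derivative - (dickman_limit (t - 1) / t)) (at t)"
proof -
  have "((\<lambda>t. 1 - integral {1..t} (\<lambda>s. dickman_limit (s - 1) / s)) has_real_derivative
      0 - dickman_limit (t - 1) / t) (at t)"
    using assms continuous_on_shift_div[OF continuous_on_dickman_limit]
    by (intro DERIV_diff DERIV_const indefinite_integral_has_real_derivative) auto
  then have "(dickman_limit has_real_derivative 0 - dickman_limit (t - 1) / t) (at t)"
    by (rule has_field_derivative_transform_within_open[where S = "{0<..}"])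
      (use assms dickman_limit_integral_eq in auto)
  then show ?thesis by simp
qed

text \<open>The next results do not presuppose positivity, which is in fact derived from them.\<close>

locale dickman_equation =
  fixes r :: "real \<Rightarrow> real"
  assumes cont: "continuous_on {0..} r"
    and eq_1: "\<And>t. 0 \<le> t \<Longrightarrow> t \<le> 1 \<Longrightarrow> r t = 1"
    and deriv: "\<And>t. t > 1 \<Longrightarrow> (r has_real_derivative - (r (t - 1) / t)) (at t)"
begin

lemma integrable: "0 \<le> a \<Longrightarrow> r integrable_on {a..b}"
  using cont by (intro integrable_continuous_real) (auto intro: continuous_on_subset)

lemma indefinite_deriv: "t > 0 \<Longrightarrow> ((\<lambda>t. integral {0..t} r) has_real_derivative r t) (at t)"
  using cont by (rule indefinite_integral_has_real_derivative)

lemma integral_eq_diff: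
  assumes "0 \<le> a" "a \<le> b"
  shows "integral {a..b} r = integral {0..b} r - integral {0..a} r"
  using Henstock_Kurzweil_Integration.integral_combine[OF assms integrable] by simp

text \<open>By the delay equation the difference of the two sides has derivative \<open>0\<close>,
  and at \<open>t = 1\<close> both sides are \<open>1\<close>. This is the continuous counterpart of
  the recurrence for the friable probabilities.\<close>

lemma window_integral:
  assumes "t \<ge> 1"
  shows "integral {t - 1..t} r = t * r t"
proof -
  let ?g = "\<lambda>t. t * r t - (integral {0..t} r - integral {0..t-1} r)"
  have contI: "continuous_on {0..} (\<lambda>t. integral {0..t} r)"
    by (rule continuous_on_indefinite_integral_atLeast[OF cont])
  have "?g t = ?g 1"
  proof (cases "t = 1")
    case False
    with assms have "1 < t" by simp
    then show ?thesis
    proof (rule DERIV_isconst2[where x = t])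
      show "continuous_on {1..t} ?g"
        by (intro continuous_intros continuous_on_compose2[OF contI] continuous_on_subset[OF cont]) auto
      fix x assume "1 < x" "x < t"
      then have d: "((\<lambda>t. integral {0..t-1} r) has_real_derivative r (x - 1)) (at x)"
        using DERIV_shift[of "\<lambda>t. integral {0..t} r" "r (x - 1)" x "-1"] indefinite_deriv[of "x - 1"]
        by simp
      have "(?g has_real_derivative 1 * r x + - (r (x - 1) / x) * x - (r x - r (x - 1))) (at x)"
        using \<open>1 < x\<close> by (intro DERIV_diff DERIV_mult DERIV_ident deriv indefinite_deriv d) auto
      then show "(?g has_real_derivative 0) (at x)" using \<open>1 < x\<close> by simp
    qed (use \<open>1 < t\<close> in auto)
  qed auto
  also have "\<dots> = 0"
  proof -
    have "integral {0..1} r = integral {0..1} (\<lambda>_::real. 1)" by (intro integral_cong) (simp add: eq_1)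
    then show ?thesis by (simp add: eq_1)
  qed
  finally show ?thesis using assms integral_eq_diff[of "t - 1" t] by simp
qed

text \<open>At the first point \<open>a\<close> where \<open>r\<close> fails to be positive, the
  window integral \<open>a * r a\<close> would be nonpositive although the integrand is positive
  before \<open>a\<close>.\<close>

lemma pos:
  assumes "t \<ge> 0"
  shows "r t > 0"
proof (rule ccontr)
  assume "\<not> r t > 0"
  define Z where "Z = {0..t} \<inter> r -` {..0}"
  have "closed Z" unfolding Z_def
    by (intro continuous_closed_preimage continuous_on_subset[OF cont]) auto
  moreover have "t \<in> Z" using \<open>\<not> r t > 0\<close> assms by (auto simp: Z_def)
  moreover have "bdd_below Z" by (auto simp: Z_def)
  ultimately have Inf: "Inf Z \<in> Z" by (intro closed_contains_Inf) auto
  define a where "a = Inf Z"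
  have a: "0 \<le> a" "a \<le> t" "r a \<le> 0" using Inf by (auto simp: Z_def a_def)
  have "a > 1" using a eq_1[of a] by (cases "a \<le> 1") auto
  have below: "r s > 0" if "0 \<le> s" "s < a" for s
  proof (rule ccontr)
    assume "\<not> r s > 0"
    then have "s \<in> Z" using that a by (auto simp: Z_def)
    then show False using cInf_lower[OF _ \<open>bdd_below Z\<close>] that by (force simp: a_def)
  qed
  have "integral {0..a-1} r < integral {0..a} r"
  proof (rule DERIV_pos_imp_increasing_open[where f = "\<lambda>t. integral {0..t} r"])
    show "a - 1 < a" by simp
    show "continuous_on {a - 1..a} (\<lambda>t. integral {0..t} r)"
      using \<open>a > 1\<close> by (intro continuous_on_subset[OF continuous_on_indefinite_integral_atLeast[OF cont]]) auto
    fix x assume "a - 1 < x" "x < a"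
    then show "\<exists>y. ((\<lambda>t. integral {0..t} r) has_real_derivative y) (at x) \<and> 0 < y"
      using indefinite_deriv[of x] below[of x] \<open>a > 1\<close> by auto
  qed
  then have "a * r a > 0"
    using window_integral[of a] integral_eq_diff[of "a - 1" a] \<open>a > 1\<close> by simp
  then show False using a by (simp add: zero_less_mult_iff)
qed

text \<open>Method of steps: between \<open>k + 1\<close> and \<open>k + 2\<close> the derivative is
  determined by the values up to \<open>k + 1\<close>, where the two solutions already
  agree.\<close>

lemma unique:
  assumes "dickman_equation s" "t \<ge> 0"
  shows "r t = s t"
proof -
  interpret s: dickman_equation s by fact
  have *: "\<forall>t. 0 \<le> t \<and> t \<le> real k + 1 \<longrightarrow> r t = s t" for k
  proof (induction k)
    case 0
    then show ?case by (simp add: eq_1 s.eq_1)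
  next
    case (Suc k)
    have "r t = s t" if t: "real k + 1 < t" "t \<le> real (Suc k) + 1" for t
    proof -
      have "r t - s t = r (real k + 1) - s (real k + 1)"
        using t(1)
      proof (rule DERIV_isconst2[where f = "\<lambda>t. r t - s t" and x = t])
        show "continuous_on {real k + 1..t} (\<lambda>t. r t - s t)"
          by (intro continuous_intros continuous_on_subset[OF cont] continuous_on_subset[OF s.cont]) auto
        fix x assume x: "real k + 1 < x" "x < t"
        then have "((\<lambda>t. r t - s t) has_real_derivative - (r (x - 1) / x) - - (s (x - 1) / x)) (at x)"
          by (intro DERIV_diff deriv s.deriv) auto
        moreover have "r (x - 1) = s (x - 1)" using Suc.IH x t by simp
        ultimately show "((\<lambda>t. r t - s t) has_real_derivative 0) (at x)" by simp
      qed (use t in auto)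
      then show ?thesis using Suc.IH by simp
    qed
    then show ?case using Suc.IH by (metis linorder_not_le)
  qed
  obtain k where "t \<le> real k" using real_arch_simple by blast
  then show ?thesis using *[of k] assms(2) by simp
qed

end

lemma dickman_equation_limit: "dickman_equation dickman_limit"
proof
  show "dickman_limit t = 1" if "0 \<le> t" "t \<le> 1" for t
    using that by (simp add: dickman_limit_integral_eq integral_atLeastAtMost_eq_0)
qed (auto intro: continuous_on_dickman_limit dickman_limit_has_derivative)

lemma dickman_equation_is_dickman:
  assumes "is_dickman r" shows "dickman_equation r"
proof
  fix t :: real assume "t > 1"
  then obtain D where D: "(r has_real_derivative D) (at t)" "t * D + r (t - 1) = 0"
    using assms by (auto simp: is_dickman_def)
  from D(2) have "D = - (r (t - 1) / t)" using \<open>t > 1\<close> by (simp add: field_simps)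
  then show "(r has_real_derivative - (r (t - 1) / t)) (at t)" using D(1) by simp
qed (use assms in \<open>auto simp: is_dickman_def\<close>)

lemma is_dickman_limit: "is_dickman dickman_limit"
proof -
  interpret dickman_equation dickman_limit by (rule dickman_equation_limit)
  have "dickman_limit t = 0" if "t < 0" for t
    using that by (simp add: dickman_limit_eq_iter[of t 0])
  moreover have "\<exists>D. (dickman_limit has_real_derivative D) (at t) \<and> t * D + dickman_limit (t - 1) = 0"
    if "t > 1" for t using that deriv[OF that] by (intro exI conjI) auto
  ultimately show ?thesis unfolding is_dickman_def using pos cont eq_1 by auto
qed

text \<open>Makes the definite description meaningful: the limit of the iterates is a solution, the
  method of steps gives uniqueness on the nonnegative reals, and the convention settles negative
  arguments.\<close>

lemma is_dickman_dickman: "is_dickman dickman"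
  unfolding dickman_def
proof (rule theI[where a = dickman_limit])
  show "is_dickman dickman_limit" by (rule is_dickman_limit)
  fix s assume s: "is_dickman s"
  show "s = dickman_limit"
  proof
    fix t show "s t = dickman_limit t"
    proof (cases "t \<ge> 0")
      case True
      then show ?thesis
        using dickman_equation.unique dickman_equation_is_dickman[OF s] dickman_equation_limit by blast
    next
      case False
      then show ?thesis using s is_dickman_limit by (auto simp: is_dickman_def)
    qed
  qed
qed

interpretation dickman: dickman_equation dickman
  by (rule dickman_equation_is_dickman[OF is_dickman_dickman])

section \<open>Counting friable permutations\<close>

text \<open>Phrased through orbits of points and for an arbitrary ground set, because the count
  proceeds by deleting points.\<close>

definition friable_perms :: "nat \<Rightarrow> 'a set \<Rightarrow> ('a \<Rightarrow> 'a) set" where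
  "friable_perms m A = {p. p permutes A \<and> (\<forall>x\<in>A. card (orbit p x) \<le> m)}"

lemma friable_on_iff_card_orbit:
  assumes "p permutes A" "finite A"
  shows "friable_on A m p \<longleftrightarrow> (\<forall>x\<in>A. card (orbit p x) \<le> m)"
proof
  assume f: "friable_on A m p"
  show "\<forall>x\<in>A. card (orbit p x) \<le> m"
  proof
    fix x assume "x \<in> A"
    then have "orbit p x \<subseteq> A" using permutes_orbit_subset[OF assms(1)] by blast
    moreover have "cyclic_on p (orbit p x)" using cyclic_on_orbit[OF assms] .
    ultimately show "card (orbit p x) \<le> m" using f unfolding friable_on_def by blast
  qed
next
  assume *: "\<forall>x\<in>A. card (orbit p x) \<le> m"
  show "friable_on A m p"
    unfolding friable_on_def
  proof (intro allI impI)
    fix c assume c: "c \<subseteq> A \<and> cyclic_on p c"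
    then obtain s where "s \<in> c" "c = orbit p s" unfolding cyclic_on_def by blast
    moreover from this(1) c have "s \<in> A" by blast
    ultimately show "card c \<le> m" using * by simp
  qed
qed

text \<open>Removing the successor of \<open>a\<close> from its cycle lowers \<open>j\<close> by one, until \<open>a\<close> is a fixed point;
  the cycle through \<open>a\<close> is therefore exempt from the length restriction.\<close>

definition pointed_friable_perms :: "nat \<Rightarrow> 'a set \<Rightarrow> 'a \<Rightarrow> nat \<Rightarrow> ('a \<Rightarrow> 'a) set" where
  "pointed_friable_perms m S a j = {p. p permutes insert a S \<and> card (orbit p a) = Suc j \<and>
     (\<forall>x\<in>insert a S - orbit p a. card (orbit p x) \<le> m)}"

lemma finite_pointed_friable_perms: "finite S \<Longrightarrow> finite (pointed_friable_perms m S a j)"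
  unfolding pointed_friable_perms_def
  by (rule finite_subset[OF _ finite_permutations[of "insert a S"]]) blast+

lemma pointed_friable_perms_0:
  assumes "finite S" "a \<notin> S"
  shows "pointed_friable_perms m S a 0 = friable_perms m S"
proof -
  have fix_iff: "card (orbit p a) = Suc 0 \<longleftrightarrow> p a = a" if "p permutes insert a S" for p
  proof -
    have "permutation p" using that assms unfolding permutation_permutes by blast
    then have "a \<in> orbit p a" by (rule permutation_self_in_orbit)
    then have "card (orbit p a) = Suc 0 \<longleftrightarrow> orbit p a = {a}"
      by (metis card_1_singletonE is_singletonI is_singleton_altdef One_nat_def singletonD)
    then show ?thesis by (simp add: orbit_eq_singleton_iff)
  qed
  have permutes_iff: "p permutes S \<longleftrightarrow> p permutes insert a S \<and> p a = a" for p
  proof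
    assume "p permutes S"
    then show "p permutes insert a S \<and> p a = a"
      using assms permutes_subset[of p S "insert a S"] permutes_not_in[of p S a] by blast
  next
    assume "p permutes insert a S \<and> p a = a"
    then show "p permutes S" using permutes_superset[of p "insert a S" S] assms by auto
  qed
  have "insert a S - {a} = S" using assms by simp
  then show ?thesis
    unfolding pointed_friable_perms_def friable_perms_def permutes_iff
    using fix_iff orbit_eq_singleton_iff[of _ a] by (intro Collect_cong) metis
qed

text \<open>As \<open>p\<close> fixes \<open>b\<close>, the map \<open>q\<close> sends
  \<open>a\<close> to \<open>b\<close> and \<open>b\<close> to \<open>p a\<close>: it inserts
  \<open>b\<close> directly after \<open>a\<close> in the cycle of \<open>a\<close> and leaves all
  other cycles alone.\<close>

lemma orbit_comp_transpose:
  assumes p: "p permutes A" and A: "finite A" "a \<in> A" "b \<notin> A"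
  defines "q \<equiv> p \<circ> Transposition.transpose a b"
  shows "orbit q a = insert b (orbit p a)"
    and "\<And>x. x \<in> A - orbit p a \<Longrightarrow> orbit q x = orbit p x"
proof -
  have pb: "p b = b" and pA: "\<And>y. y \<in> A \<Longrightarrow> p y \<in> A"
    using p A by (auto simp: permutes_def permutes_in_image[OF p])
  have q: "q a = b" "q b = p a" "\<And>y. y \<noteq> a \<Longrightarrow> y \<noteq> b \<Longrightarrow> q y = p y"
    using pb by (auto simp: q_def transpose_def)
  have orbA: "orbit p x \<subseteq> A" if "x \<in> A" for x using permutes_orbit_subset[OF p that] .
  show "orbit q a = insert b (orbit p a)"
  proof (intro equalityI subsetI)
    fix y assume "y \<in> orbit q a"
    then show "y \<in> insert b (orbit p a)"
    proof induction
      case base then show ?case using q by simp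
    next
      case (step y)
      then show ?case using q by (cases "y = b"; cases "y = a") (auto intro: orbit.intros)
    qed
  next
    fix y assume "y \<in> insert b (orbit p a)"
    moreover have b: "b \<in> orbit q a" using orbit.base[of q a] q by simp
    moreover have "y \<in> orbit q a" if "y \<in> orbit p a" for y
      using that
    proof induction
      case base then show ?case using orbit.step[OF b] q by simp
    next
      case (step y)
      have "y \<noteq> b" using step orbA[OF A(2)] A(3) by auto
      then show ?case
        using step q orbit.step[OF b] orbit.step[of y q a] by (cases "y = a") auto
    qed
    ultimately show "y \<in> orbit q a" by auto
  qed
  show "orbit q x = orbit p x" if x: "x \<in> A - orbit p a" for x
  proof (rule orbit_cong0[symmetric])
    have perm: "permutation p" using p A by (auto simp: permutation_permutes)
    show "x \<in> orbit p x" using perm by (rule permutation_self_in_orbit)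
    show "p \<in> orbit p x \<rightarrow> orbit p x" by (auto intro: orbit.step)
    have "a \<notin> orbit p x"
      using x orbit_swap[of x p a] permutation_self_in_orbit[OF perm, of x] by blast
    moreover have "b \<notin> orbit p x" using orbA[of x] x A by auto
    ultimately show "p y = q y" if "y \<in> orbit p x" for y
      using that q(3)[of y] by metis
  qed
qed

text \<open>A permutation \<open>q\<close> that moves \<open>a\<close> is determined by the
  successor \<open>b = q a\<close> and by what remains once \<open>b\<close> is cut out of the
  cycle. Cutting and inserting are composition with the same transposition, hence mutually
  inverse.\<close>

lemma bij_betw_pointed_friable_perms_Suc:
  assumes "finite S" "a \<notin> S"
  shows "bij_betw (\<lambda>(b, p). p \<circ> Transposition.transpose a b)
    (SIGMA b:S. pointed_friable_perms m (S - {b}) a j) (pointed_friable_perms m S a (Suc j))"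
proof (rule bij_betwI[where g = "\<lambda>q. (q a, q \<circ> Transposition.transpose a (q a))"])
  show "(\<lambda>(b, p). p \<circ> Transposition.transpose a b) \<in> (SIGMA b:S. pointed_friable_perms m (S - {b}) a j)
      \<rightarrow> pointed_friable_perms m S a (Suc j)"
  proof (clarsimp simp: pointed_friable_perms_def simp del: insert_iff)
    fix b p assume b: "b \<in> S" and p: "p permutes insert a (S - {b})"
      and c: "card (orbit p a) = Suc j" 
        and m: "\<forall>x\<in>insert a (S - {b}) - orbit p a. card (orbit p x) \<le> m"
    have A: "finite (insert a (S - {b}))" "a \<in> insert a (S - {b})" "b \<notin> insert a (S - {b})"
      using assms b by auto
    note o = orbit_comp_transpose[OF p A]
    have "finite (orbit p a)" 
      using permutes_orbit_subset[OF p A(2)] A(1) finite_subset by blast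
    moreover have "b \<notin> orbit p a" using permutes_orbit_subset[OF p A(2)] A by auto
    ultimately have "card (orbit (p \<circ> Transposition.transpose a b) a) = Suc (Suc j)"
      using c o(1) by simp
    moreover have "p \<circ> Transposition.transpose a b permutes insert a S"
      using b p by (intro permutes_compose permutes_swap_id) (auto elim: permutes_subset)
    moreover have "\<forall>x\<in>insert a S - orbit (p \<circ> Transposition.transpose a b) a. card (orbit (p \<circ> Transposition.transpose a b) x) \<le> m"
      using o m by auto
    ultimately show "p \<circ> Transposition.transpose a b permutes insert a S \<and>
        card (orbit (p \<circ> Transposition.transpose a b) a) = Suc (Suc j) \<and>
        (\<forall>x\<in>insert a S - orbit (p \<circ> Transposition.transpose a b) a. card (orbit (p \<circ> Transposition.transpose a b) x) \<le> m)"
      by blast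
  qed
  show "(\<lambda>q. (q a, q \<circ> Transposition.transpose a (q a))) \<in> pointed_friable_perms m S a (Suc j)
      \<rightarrow> (SIGMA b:S. pointed_friable_perms m (S - {b}) a j)"
  proof
    fix q assume "q \<in> pointed_friable_perms m S a (Suc j)"
    then have q: "q permutes insert a S" and c: "card (orbit q a) = Suc (Suc j)"
      and m: "\<forall>x\<in>insert a S - orbit q a. card (orbit q x) \<le> m"
      by (auto simp: pointed_friable_perms_def)
    define b where "b = q a"
    define p where "p = q \<circ> Transposition.transpose a b"
    have "b \<noteq> a"
    proof
      assume "b = a"
      then have "orbit q a = {a}" by (simp add: orbit_eq_singleton_iff b_def)
      then show False using c by simp
    qed
    moreover have "b \<in> insert a S" using permutes_in_image[OF q, of a] by (simp add: b_def)
    ultimately have b: "b \<in> S" by simp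
    have "p b = b" by (simp add: p_def b_def)
    moreover have "p permutes insert a S"
      unfolding p_def using b q by (intro permutes_compose permutes_swap_id) auto
    ultimately have p: "p permutes insert a (S - {b})"
      using permutes_superset[of p "insert a S" "insert a (S - {b})"] by auto
    have A: "finite (insert a (S - {b}))" "a \<in> insert a (S - {b})" "b \<notin> insert a (S - {b})"
      using assms b by auto
    have qp: "q = p \<circ> Transposition.transpose a b" by (auto simp: p_def fun_eq_iff)
    note o = orbit_comp_transpose[OF p A, folded qp]
    have "b \<notin> orbit p a" using permutes_orbit_subset[OF p A(2)] A by auto
    moreover have "finite (orbit p a)"
      using permutes_orbit_subset[OF p A(2)] A(1) finite_subset by blast
    ultimately have "card (orbit p a) = Suc j" using c o(1) by simp
    moreover have "\<forall>x\<in>insert a (S - {b}) - orbit p a. card (orbit p x) \<le> m"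
      using m o by auto
    ultimately show "(q a, q \<circ> Transposition.transpose a (q a)) \<in> (SIGMA b:S. pointed_friable_perms m (S - {b}) a j)"
      using b p by (auto simp: pointed_friable_perms_def p_def b_def)
  qed
  fix z assume "z \<in> (SIGMA b:S. pointed_friable_perms m (S - {b}) a j)"
  then obtain b p where z: "z = (b, p)" "b \<in> S" "p permutes insert a (S - {b})"
    by (auto simp: pointed_friable_perms_def)
  then have "p b = b" using assms by (auto simp: permutes_def)
  then show "(\<lambda>q. (q a, q \<circ> Transposition.transpose a (q a))) ((\<lambda>(b, p). p \<circ> Transposition.transpose a b) z) = z"
    using z by (auto simp: fun_eq_iff)
qed (simp add: comp_assoc)

text \<open>Removing the \<open>j\<close> successors of \<open>a\<close> one by one offers
  \<open>card S\<close>, \<open>card S - 1\<close>, ... choices, which completes the factorial of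
  the remaining set to that of \<open>S\<close>. So the factorial does not depend on
  \<open>j\<close>. \<open>P\<close> is kept abstract so that a strong induction can supply the
  hypothesis on subsets.\<close>

lemma card_pointed_friable_perms:
  assumes "finite S" "a \<notin> S"
    and N: "\<And>T :: 'a set. T \<subseteq> S \<Longrightarrow> real (card (friable_perms m T)) = fact (card T) * P (card T)"
  shows "j \<le> card S \<Longrightarrow>
    real (card (pointed_friable_perms m S a j)) = fact (card S) * P (card S - j)"
  using assms
proof (induction j arbitrary: S)
  case 0
  then show ?case by (simp add: pointed_friable_perms_0)
next
  case (Suc j)
  have "real (card (pointed_friable_perms m S a (Suc j)))
      = real (card (SIGMA b:S. pointed_friable_perms m (S - {b}) a j))"
    using bij_betw_same_card[OF bij_betw_pointed_friable_perms_Suc] Suc.prems by metis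
  also have "\<dots> = (\<Sum>b\<in>S. real (card (pointed_friable_perms m (S - {b}) a j)))"
    using Suc.prems by (subst card_SigmaI) (auto intro: finite_pointed_friable_perms)
  also have "\<dots> = (\<Sum>b\<in>S. fact (card S - 1) * P (card S - Suc j))"
  proof (rule sum.cong)
    fix b assume b: "b \<in> S"
    have "real (card (pointed_friable_perms m (S - {b}) a j))
        = fact (card (S - {b})) * P (card (S - {b}) - j)"
      using Suc.prems b by (intro Suc.IH) (auto simp: card_Diff_singleton)
    then show "real (card (pointed_friable_perms m (S - {b}) a j))
        = fact (card S - 1) * P (card S - Suc j)"
      using Suc.prems b by (simp add: card_Diff_singleton)
  qed simp
  also have "\<dots> = fact (card S) * P (card S - Suc j)"
    using Suc.prems by (cases "card S") auto
  finally show ?case .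
qed

text \<open>Classification by the length \<open>j + 1\<close> of the cycle through \<open>a\<close>,
  which is at most \<open>m\<close> and at most the size of the ground set.\<close>

lemma friable_perms_insert:
  assumes "finite S" "a \<notin> S"
  shows "friable_perms m (insert a S) =
    (\<Union>j<min m (Suc (card S)). pointed_friable_perms m S a j)"
proof (intro equalityI subsetI)
  fix p assume "p \<in> friable_perms m (insert a S)"
  then have p: "p permutes insert a S" and m: "\<forall>x\<in>insert a S. card (orbit p x) \<le> m"
    by (auto simp: friable_perms_def)
  have sub: "orbit p a \<subseteq> insert a S" using permutes_orbit_subset[OF p] by simp
  then have fin: "finite (orbit p a)" using assms finite_subset by blast
  have "card (orbit p a) \<le> Suc (card S)"
    using card_mono[OF _ sub] assms by simp
  moreover have "card (orbit p a) \<noteq> 0" using fin orbit_nonempty by simp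
  ultimately obtain j where "card (orbit p a) = Suc j" "j < min m (Suc (card S))"
    using m by (metis Suc_le_eq insertI1 min_less_iff_conj not0_implies_Suc)
  then show "p \<in> (\<Union>j<min m (Suc (card S)). pointed_friable_perms m S a j)"
    using p m by (auto simp: pointed_friable_perms_def)
next
  fix p assume "p \<in> (\<Union>j<min m (Suc (card S)). pointed_friable_perms m S a j)"
  then have p: "p permutes insert a S" and c: "card (orbit p a) \<le> m"
    and m: "\<forall>x\<in>insert a S - orbit p a. card (orbit p x) \<le> m"
    by (auto simp: pointed_friable_perms_def)
  have "card (orbit p x) \<le> m" if "x \<in> insert a S" for x
  proof (cases "x \<in> orbit p a")
    case True
    then have "orbit p x = orbit p a"
      using p assms cyclic_on_orbit[OF p] orbit_cyclic_eq3 by (metis finite_insert)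
    then show ?thesis using c by simp
  qed (use m that in auto)
  then show "p \<in> friable_perms m (insert a S)" using p by (auto simp: friable_perms_def)
qed

lemma card_friable_perms_insert:
  assumes "finite S" "a \<notin> S"
    and N: "\<And>T :: 'a set. T \<subseteq> S \<Longrightarrow> real (card (friable_perms m T)) = fact (card T) * P (card T)"
  shows "real (card (friable_perms m (insert a S)))
    = fact (card S) * (\<Sum>j<min m (Suc (card S)). P (card S - j))"
proof -
  have "card (friable_perms m (insert a S))
      = (\<Sum>j<min m (Suc (card S)). card (pointed_friable_perms m S a j))"
    unfolding friable_perms_insert[OF assms(1,2)] using assms(1)
    by (intro card_UN_disjoint) (auto simp: finite_pointed_friable_perms, auto simp: pointed_friable_perms_def)
  then show ?thesis
    using card_pointed_friable_perms[OF assms(1,2) N]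
    by (simp add: sum_distrib_left)
qed

fun friable_seq :: "nat \<Rightarrow> nat \<Rightarrow> real" where
  "friable_seq m n = (if n = 0 then 1 else (\<Sum>j<min m n. friable_seq m (n - 1 - j)) / real n)"

declare friable_seq.simps [simp del]

lemma card_friable_perms:
  "finite A \<Longrightarrow> real (card (friable_perms m A)) = fact (card A) * friable_seq m (card A)"
proof (induction "card A" arbitrary: A rule: less_induct)
  case less
  show ?case
  proof (cases "A = {}")
    case True
    then have "friable_perms m A = {id}" by (auto simp: friable_perms_def)
    then show ?thesis using True by (simp add: friable_seq.simps)
  next
    case False
    then obtain a S where A: "A = insert a S" "a \<notin> S" by (meson Set.set_insert ex_in_conv)
    have S: "finite S" using less.prems A by simp
    have "real (card (friable_perms m T)) = fact (card T) * friable_seq m (card T)" if "T \<subseteq> S" for T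
      using less.prems A card_mono[OF S that] S that by (intro less.hyps) (auto intro: finite_subset)
    from card_friable_perms_insert[OF S A(2) this] show ?thesis
      using A S by (simp add: friable_seq.simps[of m "Suc (card S)"] del: of_nat_Suc)
  qed
qed

lemma friable_prob_eq_friable_seq: "friable_prob n m = friable_seq m n"
proof -
  have "friable_prob n m = real (card (friable_perms m {1..n})) / fact n"
  proof -
    have "{p. p permutes {1..n}} \<inter> {p. friable_on {1..n} m p} = friable_perms m {1..n}"
      by (auto simp: friable_perms_def friable_on_iff_card_orbit)
    moreover have "card {p. p permutes {1..n}} = fact n" by (simp add: card_permutations)
    moreover have "{p. p permutes {1..n}} \<noteq> {}" using permutes_id by blast
    ultimately show ?thesis
      unfolding friable_prob_def by (simp add: measure_pmf_of_set finite_permutations)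
  qed
  then show ?thesis by (simp add: card_friable_perms)
qed

lemma friable_prob_0: "friable_prob 0 m = 1"
  by (simp add: friable_prob_eq_friable_seq friable_seq.simps)

lemma friable_prob_rec:
  assumes "n > 0"
  shows "real n * friable_prob n m = (\<Sum>k=n - min m n..<n. friable_prob k m)"
proof -
  have "real n * friable_prob n m = (\<Sum>j<min m n. friable_prob (n - 1 - j) m)"
    using assms by (simp add: friable_prob_eq_friable_seq friable_seq.simps[of m n])
  also have "\<dots> = (\<Sum>k=n - min m n..<n. friable_prob k m)"
    by (rule sum.reindex_bij_witness[of _ "\<lambda>k. n - 1 - k" "\<lambda>j. n - 1 - j"]) auto
  finally show ?thesis .
qed

lemma friable_prob_eq_1: "n \<le> m \<Longrightarrow> friable_prob n m = 1"
proof (induction n rule: less_induct)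
  case (less n)
  show ?case
  proof (cases "n = 0")
    case False
    then have "real n * friable_prob n m = (\<Sum>k=0..<n. 1)"
      using friable_prob_rec[of n m] less by (simp add: min_absorb2)
    then show ?thesis using False by simp
  qed (simp add: friable_prob_0)
qed

lemma friable_prob_pos: "m > 0 \<Longrightarrow> friable_prob n m > 0"
proof (induction n rule: less_induct)
  case (less n)
  show ?case
  proof (cases "n = 0")
    case False
    then have "0 < real n * friable_prob n m"
      using friable_prob_rec[of n m] less by (auto intro!: sum_pos)
    then show ?thesis using False by (simp add: zero_less_mult_iff)
  qed (simp add: friable_prob_0)
qed

section \<open>The logarithmic derivative of the Dickman function\<close>

lemma dickman_pos: "t \<ge> 0 \<Longrightarrow> dickman t > 0"
  by (rule dickman.pos)

text \<open>This is \<lambda> with the derivative of \<rho> eliminated by the delay equation. At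
  \<open>v = 1\<close>, where \<rho> is not differentiable, it takes the right-hand value
  \<open>1\<close>.\<close>

definition dickman_rate :: "real \<Rightarrow> real" where
  "dickman_rate v = dickman (v - 1) / (v * dickman v)"

lemma dickman_rate_pos: "v \<ge> 1 \<Longrightarrow> dickman_rate v > 0"
  by (simp add: dickman_rate_def dickman_pos)

lemma dickman_shift_eq_rate: "v \<ge> 1 \<Longrightarrow> dickman (v - 1) = v * dickman_rate v * dickman v"
  using dickman_pos[of v] by (simp add: dickman_rate_def)

lemma dickman_has_derivative:
  "t > 1 \<Longrightarrow> (dickman has_real_derivative - (dickman_rate t * dickman t)) (at t)"
  using dickman.deriv[of t] dickman_shift_eq_rate[of t] by simp

lemma dickman_strict_antimono:
  assumes "1 \<le> s" "s < t"
  shows "dickman t < dickman s"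
proof (rule DERIV_neg_imp_decreasing_open[OF assms(2)])
  show "continuous_on {s..t} dickman" by (rule continuous_on_subset[OF dickman.cont]) (use assms in auto)
  fix x assume "s < x" "x < t"
  then show "\<exists>y. (dickman has_real_derivative y) (at x) \<and> y < 0"
    using dickman_has_derivative[of x] dickman_rate_pos[of x] dickman_pos[of x] assms
    by (intro exI[of _ "- (dickman_rate x * dickman x)"]) auto
qed

lemma dickman_antimono:
  assumes "0 \<le> s" "s \<le> t"
  shows "dickman t \<le> dickman s"
proof -
  have "dickman t \<le> dickman (max 1 s)" if "1 \<le> t"
  proof -
    have "max 1 s = t \<or> max 1 s < t" using that assms by linarith
    then show ?thesis using dickman_strict_antimono[of "max 1 s" t] by auto
  qed
  then show ?thesis
    using dickman.eq_1[of s] dickman.eq_1[of t] dickman.eq_1[of 1] assms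
    by (cases "1 \<le> t"; cases "1 \<le> s") (auto simp: max_def split: if_splits)
qed

lemma dickman_le_1: "t \<ge> 0 \<Longrightarrow> dickman t \<le> 1"
  using dickman_antimono[of 0 t] dickman.eq_1[of 0] by simp

lemma continuous_on_dickman_rate: "continuous_on {1..} dickman_rate"
  unfolding dickman_rate_def
  by (intro continuous_intros continuous_on_compose2[OF dickman.cont] continuous_on_subset[OF dickman.cont])
    (auto simp: dickman_pos less_imp_neq[symmetric])

text \<open>Here the numerator \<open>dickman (t - 1)\<close> is \<open>1\<close>, while
  \<open>t * dickman t\<close> has derivative \<open>dickman t - 1 < 0\<close>. The formula for the
  derivative of the rate is available only beyond \<open>2\<close>.\<close>

lemma dickman_rate_strict_mono_1_2:
  assumes "1 \<le> s" "s < t" "t \<le> 2"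
  shows "dickman_rate s < dickman_rate t"
proof -
  have "t * dickman t < s * dickman s"
  proof (rule DERIV_neg_imp_decreasing_open[OF assms(2), where f = "\<lambda>t. t * dickman t"])
    show "continuous_on {s..t} (\<lambda>t. t * dickman t)"
      by (intro continuous_intros continuous_on_subset[OF dickman.cont]) (use assms in auto)
    fix x assume x: "s < x" "x < t"
    then have "((\<lambda>t. t * dickman t) has_real_derivative 1 * dickman x + - (dickman (x - 1) / x) * x) (at x)"
      using assms by (intro DERIV_mult DERIV_ident dickman.deriv) auto
    moreover have "dickman x < dickman 1" "dickman (x - 1) = 1" "dickman 1 = 1"
      using x assms by (auto intro: dickman_strict_antimono dickman.eq_1)
    ultimately show "\<exists>y. ((\<lambda>t. t * dickman t) has_real_derivative y) (at x) \<and> y < 0"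
      using x assms by (intro exI[of _ "dickman x - 1"]) auto
  qed
  moreover have "dickman (s - 1) = 1" "dickman (t - 1) = 1" using assms by (auto intro: dickman.eq_1)
  moreover have "t * dickman t > 0" using assms by (simp add: dickman_pos)
  ultimately show ?thesis by (simp add: dickman_rate_def frac_less2)
qed

text \<open>Logarithmic differentiation: the numerator contributes
  \<open>- dickman_rate (t - 1)\<close>, the factors \<open>t\<close> and \<open>dickman t\<close>
  of the denominator contribute \<open>- 1 / t\<close> and \<open>dickman_rate t\<close>.\<close>

lemma dickman_rate_has_derivative:
  assumes "t > 2"
  shows "(dickman_rate has_real_derivative
    dickman_rate t * (dickman_rate t - dickman_rate (t - 1) - 1 / t)) (at t)"
proof -
  have N: "((\<lambda>t. dickman (t - 1)) has_real_derivative - (dickman_rate (t - 1) * dickman (t - 1))) (at t)"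
    using DERIV_shift[of dickman _ t "-1"] dickman_has_derivative[of "t - 1"] assms by simp
  have D: "((\<lambda>t. t * dickman t) has_real_derivative 1 * dickman t + - (dickman_rate t * dickman t) * t) (at t)"
    using assms by (intro DERIV_mult DERIV_ident dickman_has_derivative) auto
  have p: "dickman t > 0" "t > 0" using assms by (auto simp: dickman_pos)
  have "(dickman_rate has_real_derivative
     (- (dickman_rate (t - 1) * dickman (t - 1)) * (t * dickman t) -
        dickman (t - 1) * (1 * dickman t + - (dickman_rate t * dickman t) * t)) /
       ((t * dickman t) * (t * dickman t))) (at t)"
    using DERIV_divide[OF N D] p unfolding dickman_rate_def by simp
  moreover have "(- (l' * (t * l * r)) * (t * r) - (t * l * r) * (1 * r + - (l * r) * t)) /
       ((t * r) * (t * r)) = l * (l - l' - 1 / t)" if "r > 0" for l l' r :: real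
    using that p(2) by (simp add: field_simps)
  ultimately show ?thesis
    using p assms dickman_shift_eq_rate[of t] by simp
qed

text \<open>The logarithmic derivative of \<open>dickman_rate\<close> at \<open>t > 2\<close> is the left-hand side. Integrating
  \<open>- \<rho>' = dickman_rate * \<rho>\<close> over \<open>{t - 1..t}\<close> exhibits \<open>dickman_rate t - 1 / t\<close> as an average of
  \<open>dickman_rate\<close> over that window, so the first zero of the left-hand side would contradict
  monotonicity up to that point.\<close>

lemma dickman_rate_gap_pos:
  assumes "t \<ge> 2"
  shows "dickman_rate t - dickman_rate (t - 1) - 1 / t > 0"
proof (rule ccontr)
  let ?g = "\<lambda>t. dickman_rate t - dickman_rate (t - 1) - 1 / t"
  assume "\<not> ?g t > 0"
  define Z where "Z = {2..t} \<inter> ?g -` {..0}"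
  have "closed Z" unfolding Z_def
    by (intro continuous_closed_preimage continuous_intros continuous_on_compose2[OF continuous_on_dickman_rate]
        continuous_on_subset[OF continuous_on_dickman_rate]) auto
  moreover have "t \<in> Z" using \<open>\<not> ?g t > 0\<close> assms by (auto simp: Z_def)
  moreover have bdd: "bdd_below Z" by (auto simp: Z_def)
  ultimately have Inf: "Inf Z \<in> Z" by (intro closed_contains_Inf) auto
  define a where "a = Inf Z"
  have a: "2 \<le> a" "a \<le> t" "?g a \<le> 0" using Inf by (auto simp: Z_def a_def)
  have below: "?g s > 0" if "2 \<le> s" "s < a" for s
  proof (rule ccontr)
    assume "\<not> ?g s > 0"
    then have "s \<in> Z" using that a by (auto simp: Z_def)
    then show False using cInf_lower[OF _ bdd] that by (force simp: a_def)
  qed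
  have mono2: "dickman_rate x < dickman_rate y" if "2 \<le> x" "x < y" "y \<le> a" for x y
  proof (rule DERIV_pos_imp_increasing_open[OF that(2)])
    show "continuous_on {x..y} dickman_rate"
      by (rule continuous_on_subset[OF continuous_on_dickman_rate]) (use that in auto)
    fix z assume z: "x < z" "z < y"
    then have "dickman_rate z * ?g z > 0"
      using that below[of z] dickman_rate_pos[of z] by simp
    then show "\<exists>d. (dickman_rate has_real_derivative d) (at z) \<and> 0 < d"
      using dickman_rate_has_derivative[of z] z that by auto
  qed
  have mono: "dickman_rate x < dickman_rate y" if "1 \<le> x" "x < y" "y \<le> a" for x y
    using mono2[of x y] mono2[of 2 y] dickman_rate_strict_mono_1_2[of x y]
      dickman_rate_strict_mono_1_2[of x 2] that
    by (cases "y \<le> 2"; cases "2 \<le> x"; cases "x = 2") auto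
  \<comment> \<open>\<open>c\<close> is the least rate on the window \<open>{a - 1..a}\<close>, so
    the average \<open>dickman_rate a - 1 / a\<close> must exceed it. For \<open>a = 2\<close>
    strict growth on \<open>{1..2}\<close> alone supplies the monotonicity.\<close>
  define c where "c = dickman_rate (a - 1)"
  let ?\<phi> = "\<lambda>s. - dickman s - c * integral {0..s} dickman"
  have "?\<phi> (a - 1) < ?\<phi> a"
  proof (rule DERIV_pos_imp_increasing_open[where f = ?\<phi>])
    show "continuous_on {a - 1..a} ?\<phi>"
      using a by (intro continuous_intros continuous_on_subset[OF dickman.cont]
          continuous_on_subset[OF continuous_on_indefinite_integral_atLeast[OF dickman.cont]]) auto
    fix x assume x: "a - 1 < x" "x < a"
    have "(?\<phi> has_real_derivative - (- (dickman_rate x * dickman x)) - c * dickman x) (at x)"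
      using x a by (intro DERIV_diff DERIV_minus DERIV_cmult dickman.indefinite_deriv dickman_has_derivative) auto
    moreover have "(dickman_rate x - c) * dickman x > 0"
      using x a mono[of "a - 1" x] dickman_pos[of x] by (simp add: c_def)
    ultimately show "\<exists>y. (?\<phi> has_real_derivative y) (at x) \<and> 0 < y"
      by (auto simp: algebra_simps)
  qed simp
  then have "c * (integral {0..a} dickman - integral {0..a - 1} dickman) < dickman (a - 1) - dickman a"
    by (simp add: algebra_simps)
  also have "integral {0..a} dickman - integral {0..a - 1} dickman = a * dickman a"
    using dickman.window_integral[of a] dickman.integral_eq_diff[of "a - 1" a] a by simp
  also have "dickman (a - 1) - dickman a = (dickman_rate a - 1 / a) * (a * dickman a)"
    using dickman_shift_eq_rate[of a] a by (simp add: left_diff_distrib)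
  finally have "c * (a * dickman a) < (dickman_rate a - 1 / a) * (a * dickman a)" .
  then have "c < dickman_rate a - 1 / a"
    using dickman_pos[of a] a by (subst (asm) mult_less_cancel_right_pos) auto
  then show False using a by (simp add: c_def)
qed

text \<open>This is log-concavity of \<rho> on \<open>{1..}\<close>, the source of all exponential
  comparisons that follow.\<close>

lemma dickman_rate_mono:
  assumes "1 \<le> x" "x \<le> y"
  shows "dickman_rate x \<le> dickman_rate y"
proof -
  have mono2: "dickman_rate x \<le> dickman_rate y" if "2 \<le> x" "x \<le> y" for x y
  proof (rule DERIV_nonneg_imp_increasing_open[OF that(2)])
    show "continuous_on {x..y} dickman_rate"
      by (rule continuous_on_subset[OF continuous_on_dickman_rate]) (use that in auto)
    fix z assume z: "x < z" "z < y"
    then have "dickman_rate z * (dickman_rate z - dickman_rate (z - 1) - 1 / z) > 0"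
      using that dickman_rate_gap_pos[of z] dickman_rate_pos[of z] by simp
    then show "\<exists>d. (dickman_rate has_real_derivative d) (at z) \<and> 0 \<le> d"
      using dickman_rate_has_derivative[of z] z that by (auto intro: less_imp_le)
  qed
  have mono1: "dickman_rate x \<le> dickman_rate y" if "1 \<le> x" "x \<le> y" "y \<le> 2" for x y
    using dickman_rate_strict_mono_1_2[of x y] that by (cases "x = y") auto
  show ?thesis
    using mono2[of x y] mono2[of 2 y] mono1[of x y] mono1[of x 2] assms
    by (cases "y \<le> 2"; cases "2 \<le> x") auto
qed

lemma dickman_rate_ge_1: "v \<ge> 1 \<Longrightarrow> dickman_rate v \<ge> 1"
  using dickman_rate_mono[of 1 v] by (simp add: dickman_rate_def dickman.eq_1)

lemma dickman_le_exp_right: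
  assumes "1 \<le> x" "x \<le> a" "a \<le> b"
  shows "dickman b \<le> dickman a * exp (- (dickman_rate x * (b - a)))"
proof -
  define c where "c = dickman_rate x"
  let ?f = "\<lambda>s. dickman s * exp (c * s)"
  have "?f b \<le> ?f a"
  proof (rule DERIV_nonpos_imp_decreasing_open[OF assms(3), where f = ?f])
    show "continuous_on {a..b} ?f"
      using assms by (intro continuous_intros continuous_on_subset[OF dickman.cont]) auto
    fix s assume s: "a < s" "s < b"
    have "(?f has_real_derivative (c - dickman_rate s) * (dickman s * exp (c * s))) (at s)"
      using s assms by (auto intro!: derivative_eq_intros dickman_has_derivative simp: algebra_simps)
    moreover have "(c - dickman_rate s) * (dickman s * exp (c * s)) \<le> 0"
      using dickman_rate_mono[of x s] dickman_pos[of s] s assms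
      by (intro mult_nonpos_nonneg) (auto simp: c_def)
    ultimately show "\<exists>y. (?f has_real_derivative y) (at s) \<and> y \<le> 0" by blast
  qed
  then have "?f b * exp (- (c * b)) \<le> ?f a * exp (- (c * b))" by (intro mult_right_mono) auto
  then show ?thesis by (simp add: c_def mult.assoc exp_add[symmetric] algebra_simps)
qed

lemma dickman_le_exp_left:
  assumes "1 \<le> x" "0 \<le> y" "y \<le> x"
  shows "dickman y \<le> dickman x * exp (dickman_rate x * (x - y))"
proof -
  define c where "c = dickman_rate x"
  let ?f = "\<lambda>s. dickman s * exp (c * s)"
  \<comment> \<open>Below \<open>1\<close> the function is constant while the exponential on the
    right still grows as \<open>y\<close> decreases, so it is enough to argue from
    \<open>max 1 y\<close>.\<close>
  let ?y = "max 1 y"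
  have "?y \<le> x" using assms by simp
  then have "?f ?y \<le> ?f x"
  proof (rule DERIV_nonneg_imp_increasing_open[where f = ?f])
    show "continuous_on {?y..x} ?f"
      using assms by (intro continuous_intros continuous_on_subset[OF dickman.cont]) auto
    fix s assume s: "?y < s" "s < x"
    have "(?f has_real_derivative (c - dickman_rate s) * (dickman s * exp (c * s))) (at s)"
      using s assms by (auto intro!: derivative_eq_intros dickman_has_derivative simp: algebra_simps)
    moreover have "(c - dickman_rate s) * (dickman s * exp (c * s)) \<ge> 0"
      using dickman_rate_mono[of s x] dickman_pos[of s] s assms
      by (intro mult_nonneg_nonneg) (auto simp: c_def)
    ultimately show "\<exists>y. (?f has_real_derivative y) (at s) \<and> 0 \<le> y" by blast
  qed
  then have "?f ?y * exp (- (c * ?y)) \<le> ?f x * exp (- (c * ?y))" by (intro mult_right_mono) auto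
  then have "dickman ?y \<le> dickman x * exp (c * (x - ?y))"
    by (simp add: mult.assoc exp_add[symmetric] algebra_simps)
  also have "\<dots> \<le> dickman x * exp (c * (x - y))"
    using dickman_pos[of x] dickman_rate_pos[of x] assms by (intro mult_left_mono) (auto simp: c_def)
  finally have "dickman ?y \<le> dickman x * exp (c * (x - y))" .
  moreover have "dickman ?y = dickman y"
    using assms dickman.eq_1[of y] dickman.eq_1[of 1] by (auto simp: max_def)
  ultimately show ?thesis by (simp add: c_def)
qed

text \<open>Log-concavity as a supporting line: the logarithm of \<rho> lies below the line through
  \<open>x\<close> with slope \<open>- dickman_rate x\<close>.\<close>

lemma dickman_le_exp:
  assumes "1 \<le> x" "0 \<le> y"
  shows "dickman y \<le> dickman x * exp (dickman_rate x * (x - y))"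
  using dickman_le_exp_left[OF assms] dickman_le_exp_right[OF assms(1) order.refl, of y]
  by (cases "y \<le> x") (auto simp: algebra_simps)

text \<open>Convexity on \<open>{1..}\<close>: the negative derivative
  \<open>dickman (s - 1) / s\<close> decreases in \<open>s\<close>. It does not extend below
  \<open>1\<close>, where the slope jumps from \<open>0\<close> to \<open>-1\<close>.\<close>

lemma dickman_ge_tangent:
  assumes "1 \<le> x" "1 \<le> y"
  shows "dickman y \<ge> dickman x - dickman_rate x * dickman x * (y - x)"
proof -
  define d where "d = dickman (x - 1) / x"
  let ?f = "\<lambda>s. dickman s + d * s"
  have deriv: "(?f has_real_derivative d - dickman (s - 1) / s) (at s)" if "s > 1" for s
    using that dickman.deriv[of s] by (auto intro!: derivative_eq_intros)
  have mono: "dickman (t - 1) / t \<le> dickman (s - 1) / s" if "1 \<le> s" "s \<le> t" for s t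
    using that dickman_antimono[of "s - 1" "t - 1"] dickman_pos[of "t - 1"] by (intro frac_le) auto
  have cont: "continuous_on {s..t} ?f" if "s \<ge> 1" for s t
    using that by (intro continuous_intros continuous_on_subset[OF dickman.cont]) auto
  have "?f x \<le> ?f y"
  proof (cases "x \<le> y")
    case True
    then show ?thesis
    proof (rule DERIV_nonneg_imp_increasing_open[where f = ?f])
      fix s assume "x < s" "s < y"
      then show "\<exists>z. (?f has_real_derivative z) (at s) \<and> 0 \<le> z"
        using deriv[of s] mono[of x s] assms by (auto simp: d_def)
    qed (use cont assms in auto)
  next
    case False
    then have "y \<le> x" by simp
    then show ?thesis
    proof (rule DERIV_nonpos_imp_decreasing_open[where f = ?f])
      fix s assume "y < s" "s < x"
      then show "\<exists>z. (?f has_real_derivative z) (at s) \<and> z \<le> 0"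
        using deriv[of s] mono[of s x] assms by (auto simp: d_def)
    qed (use cont assms in auto)
  qed
  moreover have "d = dickman_rate x * dickman x"
    using dickman_shift_eq_rate[of x] assms by (simp add: d_def)
  ultimately show ?thesis by (simp add: algebra_simps)
qed

section \<open>Integrals of \<open>dickman\<close> over windows and cells; comparison of the rate
  with \<open>xi\<close>\<close>

lemma has_integral_exp_window:
  fixes a b c x :: real
  assumes "a \<le> b" "c \<noteq> 0"
  shows "((\<lambda>s. exp (c * (x - s))) has_integral (exp (c * (x - a)) - exp (c * (x - b))) / c) {a..b}"
proof -
  have "((\<lambda>s. exp (c * (x - s))) has_integral
      (- exp (c * (x - b)) / c) - (- exp (c * (x - a)) / c)) {a..b}"
    using assms by (intro fundamental_theorem_of_calculus)
      (auto intro!: derivative_eq_intros simp: has_real_derivative_iff_has_vector_derivative[symmetric])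
  then show ?thesis by (simp add: diff_divide_distrib)
qed

lemma integral_dickman_le:
  assumes "1 \<le> x" "0 \<le> a" "a \<le> b"
  shows "integral {a..b} dickman \<le>
    dickman x * ((exp (dickman_rate x * (x - a)) - exp (dickman_rate x * (x - b))) / dickman_rate x)"
proof (rule has_integral_le)
  show "(dickman has_integral integral {a..b} dickman) {a..b}"
    using assms by (intro integrable_integral dickman.integrable)
  show "((\<lambda>s. dickman x * exp (dickman_rate x * (x - s))) has_integral
    dickman x * ((exp (dickman_rate x * (x - a)) - exp (dickman_rate x * (x - b))) / dickman_rate x)) {a..b}"
    using assms dickman_rate_pos[of x] by (intro has_integral_mult_right has_integral_exp_window) auto
qed (use assms dickman_le_exp in auto)

text \<open>The window identity on \<open>{v - 1..v}\<close>, with the integrand replaced by its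
  exponential majorant at \<open>v\<close>.\<close>

lemma mult_dickman_rate_le_exp:
  assumes "v \<ge> 1"
  shows "v * dickman_rate v \<le> exp (dickman_rate v) - 1"
proof -
  have p: "dickman v > 0" "dickman_rate v > 0" using assms by (auto simp: dickman_pos dickman_rate_pos)
  have "dickman v * v \<le> dickman v * ((exp (dickman_rate v) - 1) / dickman_rate v)"
    using integral_dickman_le[of v "v - 1" v] dickman.window_integral[of v] assms by (simp add: mult.commute)
  then have "v \<le> (exp (dickman_rate v) - 1) / dickman_rate v"
    using p by (subst (asm) mult_le_cancel_left_pos) auto
  then show ?thesis using p by (simp add: field_simps)
qed

text \<open>For a bound in the other direction the window is \<open>{v..v + 1}\<close>: there the
  rate is at least \<open>dickman_rate v\<close>, which gives an exponential minorant. This shift is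
  the origin of \<open>v + 1\<close>.\<close>

lemma exp_dickman_rate_le:
  assumes "v \<ge> 1"
  shows "exp (dickman_rate v) - 1 \<le> (v + 1) * dickman_rate v"
proof -
  define c where "c = dickman_rate v"
  have c: "c > 0" using assms by (simp add: c_def dickman_rate_pos)
  have p: "dickman (v + 1) > 0" using assms by (simp add: dickman_pos)
  have "dickman (v + 1) * ((exp (c * (v + 1 - v)) - exp (c * (v + 1 - (v + 1)))) / c)
      \<le> integral {v..v+1} dickman"
  proof (rule has_integral_le)
    show "(dickman has_integral integral {v..v+1} dickman) {v..v+1}"
      using assms by (intro integrable_integral dickman.integrable) auto
    show "((\<lambda>s. dickman (v + 1) * exp (c * (v + 1 - s))) has_integral
      dickman (v + 1) * ((exp (c * (v + 1 - v)) - exp (c * (v + 1 - (v + 1)))) / c)) {v..v+1}"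
      using c by (intro has_integral_mult_right has_integral_exp_window) auto
    fix s assume "s \<in> {v..v+1}"
    then have "dickman (v + 1) * exp (c * (v + 1 - s))
        \<le> dickman s * exp (- (c * (v + 1 - s))) * exp (c * (v + 1 - s))"
      using dickman_le_exp_right[of v s "v + 1"] assms by (intro mult_right_mono) (auto simp: c_def)
    then show "dickman (v + 1) * exp (c * (v + 1 - s)) \<le> dickman s"
      by (simp add: mult.assoc exp_add[symmetric])
  qed
  also have "\<dots> = dickman (v + 1) * (v + 1)"
    using dickman.window_integral[of "v + 1"] assms by simp
  finally have "dickman (v + 1) * ((exp c - 1) / c) \<le> dickman (v + 1) * (v + 1)" by simp
  then have "(exp c - 1) / c \<le> v + 1"
    using p by (subst (asm) mult_le_cancel_left_pos) auto
  then show ?thesis using c by (simp add: c_def[symmetric] field_simps)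
qed

text \<open>Comparison with slope \<open>1\<close>, whose root \<open>0\<close> is inadmissible in
  \<open>exp_eq_root_le\<close> and is approached by arbitrarily small \<open>e > 0\<close>.\<close>

lemma root_le_two_ln:
  fixes y a :: real
  assumes "1 \<le> a" "0 < y" "exp y - 1 \<le> a * y"
  shows "y \<le> 2 * ln a"
proof (rule field_le_epsilon)
  fix e :: real assume "0 < e"
  have "1 * e \<le> exp e - 1" using exp_ge_add_one_self[of e] by linarith
  then show "y \<le> 2 * ln a + e"
    using exp_eq_root_le[of e y 1 a] assms \<open>0 < e\<close> by simp
qed

lemma dickman_rate_le: "v \<ge> 1 \<Longrightarrow> dickman_rate v \<le> 2 * ln (v + 1)"
  using root_le_two_ln[of "v + 1" "dickman_rate v"] exp_dickman_rate_le[of v] dickman_rate_pos[of v] by simp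

lemma xi_nonneg: "u \<ge> 1 \<Longrightarrow> xi u \<ge> 0"
  using xi_pos[of u] by (cases "u > 1") (auto simp: xi_def)

lemma xi_le: "u \<ge> 1 \<Longrightarrow> xi u \<le> 2 * ln u"
  using root_le_two_ln[of u "xi u"] xi_props[of u] by (cases "u > 1") (auto simp: xi_def)

lemma xi_le_dickman_rate:
  assumes "1 \<le> v" "v \<le> u"
  shows "xi u \<le> dickman_rate v + 2 * ln (u / v)"
proof (cases "u > 1")
  case True
  then show ?thesis
    using exp_eq_root_le[of "dickman_rate v" "xi u" v u] xi_props[of u] assms
      mult_dickman_rate_le_exp[of v] dickman_rate_pos[of v] by simp
next
  case False
  then show ?thesis using assms dickman_rate_pos[of v] by (simp add: xi_def)
qed

lemma dickman_rate_le_xi: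
  assumes "u > 1"
  shows "dickman_rate u \<le> xi u + 2 * ln ((u + 1) / u)"
  using exp_eq_root_le[of "xi u" "dickman_rate u" u "u + 1"] xi_props[of u] assms
      exp_dickman_rate_le[of u] dickman_rate_pos[of u] by simp

text \<open>The exponential majorant centred at \<open>x\<close> integrates to a multiple of
  \<open>sinh\<close>: first-order terms cancel, and the excess is quadratic in
  \<open>dickman_rate x * h\<close>.\<close>

lemma integral_dickman_cell_le:
  assumes "1 \<le> x" "0 \<le> h" "h \<le> x"
  shows "integral {x - h..x + h} dickman \<le> 2 * h * dickman x * exp ((dickman_rate x * h)\<^sup>2 / 2)"
proof -
  define c where "c = dickman_rate x"
  have c: "c > 0" using assms by (simp add: c_def dickman_rate_pos)
  have "integral {x - h..x + h} dickman \<le> dickman x * ((exp (c * h) - exp (- (c * h))) / c)"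
    using integral_dickman_le[of x "x - h" "x + h"] assms by (simp add: c_def)
  also have "(exp (c * h) - exp (- (c * h))) / c = 2 * sinh (c * h) / c"
    using c by (simp add: sinh_field_def field_simps)
  also have "\<dots> \<le> 2 * (c * h * exp ((c * h)\<^sup>2 / 2)) / c"
    using sinh_le_exp_square[of "c * h"] assms c by (intro divide_right_mono mult_left_mono) auto
  also have "\<dots> = 2 * h * exp ((c * h)\<^sup>2 / 2)" using c by simp
  finally show ?thesis
    using dickman_pos[of x] assms by (simp add: c_def mult_ac)
qed

text \<open>On one side of \<open>x\<close> nothing cancels and the excess is of first order. This
  is affordable because a window contains a single half cell.\<close>

lemma integral_dickman_half_cell_le:
  assumes "1 \<le> x" "0 \<le> h" "h \<le> x"
  shows "integral {x - h..x} dickman \<le> h * dickman x * exp (dickman_rate x * h)"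
proof -
  define c where "c = dickman_rate x"
  have c: "c > 0" using assms by (simp add: c_def dickman_rate_pos)
  have "(1 - c * h) * exp (c * h) \<le> exp (- (c * h)) * exp (c * h)"
    using exp_ge_add_one_self[of "- (c * h)"] by (intro mult_right_mono) auto
  then have "exp (c * h) - 1 \<le> c * h * exp (c * h)"
    by (simp add: exp_minus algebra_simps)
  then have "(exp (c * h) - 1) / c \<le> h * exp (c * h)"
    using c by (simp add: field_simps)
  moreover have "integral {x - h..x} dickman \<le> dickman x * ((exp (c * h) - 1) / c)"
    using integral_dickman_le[of x "x - h" "x"] assms by (simp add: c_def)
  ultimately show ?thesis
    using dickman_pos[of x] assms mult_left_mono[of "(exp (c * h) - 1) / c" "h * exp (c * h)" "dickman x"]
    by (simp add: c_def mult_ac)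
qed

text \<open>Midpoint rule for a convex function: the linear part of the tangent integrates to
  \<open>0\<close>. The whole cell must lie in \<open>{1..}\<close>.\<close>

lemma integral_dickman_cell_ge:
  assumes "0 \<le> h" "1 \<le> x - h"
  shows "2 * h * dickman x \<le> integral {x - h..x + h} dickman"
proof -
  define d where "d = dickman_rate x * dickman x"
  have "((\<lambda>s. dickman x - d * (s - x)) has_integral
      (dickman x * (x + h) - d * (x + h - x)\<^sup>2 / 2) - (dickman x * (x - h) - d * (x - h - x)\<^sup>2 / 2)) {x - h..x + h}"
    using assms by (intro fundamental_theorem_of_calculus)
      (auto intro!: derivative_eq_intros simp: has_real_derivative_iff_has_vector_derivative[symmetric])
  moreover have "(dickman has_integral integral {x - h..x + h} dickman) {x - h..x + h}"
    using assms by (intro integrable_integral dickman.integrable) auto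
  ultimately have "(dickman x * (x + h) - d * (x + h - x)\<^sup>2 / 2) - (dickman x * (x - h) - d * (x - h - x)\<^sup>2 / 2)
      \<le> integral {x - h..x + h} dickman"
    by (rule has_integral_le) (use assms dickman_ge_tangent[of x] in \<open>auto simp: d_def\<close>)
  then show ?thesis by (simp add: algebra_simps)
qed

lemma ln_dickman_diff_bounds:
  assumes "1 \<le> v" "v \<le> u"
  shows "dickman_rate v * (u - v) \<le> ln (dickman v) - ln (dickman u)"
    and "ln (dickman v) - ln (dickman u) \<le> dickman_rate u * (u - v)"
proof -
  have p: "dickman u > 0" "dickman v > 0" using assms by (auto simp: dickman_pos)
  have "ln (dickman u) \<le> ln (dickman v * exp (- (dickman_rate v * (u - v))))"
    using dickman_le_exp_right[of v v u] assms p by (intro ln_mono) auto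
  then show "dickman_rate v * (u - v) \<le> ln (dickman v) - ln (dickman u)"
    using p by (simp add: ln_mult)
  have "ln (dickman v) \<le> ln (dickman u * exp (dickman_rate u * (u - v)))"
    using dickman_le_exp_left[of u v] assms p by (intro ln_mono) auto
  then show "ln (dickman v) - ln (dickman u) \<le> dickman_rate u * (u - v)"
    using p by (simp add: ln_mult)
qed

section \<open>Comparison of the two recurrences\<close>

text \<open>The nodes are spaced \<open>1 / (m + 1/2)\<close> apart, and node \<open>m\<close> is \<open>1\<close>; the cell around a node is
  the interval of radius \<open>cell_radius m\<close>. A window of length \<open>1\<close> ending at node \<open>n\<close> then consists of
  the \<open>m\<close> preceding cells and half a cell.\<close>

definition cell_radius :: "nat \<Rightarrow> real" where
  "cell_radius m = 1 / (2 * real m + 1)"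

definition node :: "nat \<Rightarrow> nat \<Rightarrow> real" where
  "node m n = (2 * real n + 1) / (2 * real m + 1)"

lemma cell_radius_pos: "cell_radius m > 0"
  by (simp add: cell_radius_def)

lemma cell_radius_le: "m \<ge> 1 \<Longrightarrow> cell_radius m \<le> 1 / 3"
  by (simp add: cell_radius_def)

lemma node_minus: "node m n - cell_radius m = 2 * real n * cell_radius m"
  by (simp add: node_def cell_radius_def diff_divide_distrib[symmetric])

lemma cell_radius_le_node: "cell_radius m \<le> node m n"
  by (simp add: node_def cell_radius_def divide_right_mono)

lemma node_plus: "node m n + cell_radius m = 2 * real (Suc n) * cell_radius m"
  by (simp add: node_def cell_radius_def field_simps)

lemma node_self: "node m m = 1"
  by (simp add: node_def)

lemma node_mono: "k \<le> n \<Longrightarrow> node m k \<le> node m n"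
  by (simp add: node_def divide_right_mono)

lemma node_pos: "node m n > 0"
  by (simp add: node_def)

lemma dickman_node_le: "n \<le> m \<Longrightarrow> dickman (node m n) = 1"
  using node_mono[of n m m] node_pos[of m n] by (intro dickman.eq_1) (auto simp: node_self)

definition cell_integral :: "nat \<Rightarrow> nat \<Rightarrow> real" where
  "cell_integral m k = integral {node m k - cell_radius m..node m k + cell_radius m} dickman"

text \<open>The window identity at node \<open>n\<close>, cut into cells. As
  \<open>1 = (2 * m + 1) * cell_radius m\<close>, the window starts at the left end of cell
  \<open>n - m\<close>. Since node \<open>n\<close> is \<open>(2 * n + 1) * cell_radius m\<close>,
  moving one \<open>cell_radius m * dickman (node m n)\<close> to the right leaves the factor
  \<open>n\<close> of the discrete recurrence.\<close>

lemma dickman_node_eq: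
  assumes "m < n"
  shows "2 * cell_radius m * (real n * dickman (node m n)) = (\<Sum>k=n-m..<n. cell_integral m k)
    + (integral {node m n - cell_radius m..node m n} dickman - cell_radius m * dickman (node m n))"
proof -
  let ?h = "cell_radius m"
  define I where "I t = integral {0..t} dickman" for t
  have h: "?h > 0" by (rule cell_radius_pos)
  have cell: "cell_integral m k = I (2 * real (Suc k) * ?h) - I (2 * real k * ?h)" for k
  proof -
    have "cell_integral m k = I (node m k + ?h) - I (node m k - ?h)"
      unfolding cell_integral_def I_def
      by (rule dickman.integral_eq_diff) (use h cell_radius_le_node[of m k] in auto)
    then show ?thesis by (simp only: node_plus node_minus)
  qed
  have "(\<Sum>k=n-m..<n. cell_integral m k) = I (2 * real n * ?h) - I (2 * real (n - m) * ?h)"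
    unfolding cell by (rule sum_Suc_diff') simp
  also have "2 * real (n - m) * ?h = node m n - 1"
    using assms by (simp add: node_def cell_radius_def of_nat_diff field_simps)
  also have "I (2 * real n * ?h) = I (node m n - ?h)" by (simp add: node_minus)
  finally have sum: "(\<Sum>k=n-m..<n. cell_integral m k) = I (node m n - ?h) - I (node m n - 1)" .
  have "integral {node m n - ?h..node m n} dickman = I (node m n) - I (node m n - ?h)"
    unfolding I_def by (rule dickman.integral_eq_diff) (use h cell_radius_le_node[of m n] in auto)
  moreover have "node m n * dickman (node m n) = I (node m n) - I (node m n - 1)"
    using node_mono[of m n m] assms dickman.window_integral[of "node m n"]
      dickman.integral_eq_diff[of "node m n - 1" "node m n"] by (simp add: node_self I_def)
  moreover have "node m n = 2 * ?h * real n + ?h"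
    using node_minus[of m n] by (simp add: algebra_simps)
  then have "node m n * dickman (node m n)
      = 2 * ?h * (real n * dickman (node m n)) + ?h * dickman (node m n)"
    by (metis distrib_right mult.assoc)
  ultimately show ?thesis using sum by linarith
qed

lemma integral_dickman_ge_const:
  assumes "0 \<le> a" "a \<le> b"
  shows "(b - a) * dickman b \<le> integral {a..b} dickman"
proof (rule has_integral_le)
  show "((\<lambda>_. dickman b) has_integral (b - a) * dickman b) {a..b}"
    using has_integral_const_real[of "dickman b" a b] assms by simp
  show "(dickman has_integral integral {a..b} dickman) {a..b}"
    using assms by (intro integrable_integral dickman.integrable)
qed (use assms in \<open>auto intro: dickman_antimono\<close>)

lemma integral_dickman_le_length:
  assumes "0 \<le> a" "a \<le> b"
  shows "integral {a..b} dickman \<le> b - a"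
proof (rule has_integral_le)
  show "((\<lambda>_. 1) has_integral b - a) {a..b}"
    using has_integral_const_real[of "1::real" a b] assms by simp
  show "(dickman has_integral integral {a..b} dickman) {a..b}"
    using assms by (intro integrable_integral dickman.integrable)
qed (use assms in \<open>auto intro: dickman_le_1\<close>)

text \<open>The node values form a supersolution of the recurrence: for \<open>n > 2 * m\<close> all
  cells lie in \<open>{1..}\<close>, where convexity applies, and monotonicity bounds the half
  cell.\<close>

lemma sum_dickman_node_le:
  assumes "2 * m < n"
  shows "(\<Sum>k=n-m..<n. dickman (node m k)) \<le> real n * dickman (node m n)"
proof -
  let ?h = "cell_radius m"
  have h: "?h > 0" by (rule cell_radius_pos)
  have "2 * ?h * dickman (node m k) \<le> cell_integral m k" if "k \<in> {n-m..<n}" for k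
    unfolding cell_integral_def
  proof (rule integral_dickman_cell_ge)
    have "real k \<ge> real m + 1" using that assms by simp linarith
    then show "1 \<le> node m k - ?h" unfolding node_minus by (simp add: cell_radius_def)
  qed (use h in simp)
  then have "(\<Sum>k=n-m..<n. 2 * ?h * dickman (node m k)) \<le> (\<Sum>k=n-m..<n. cell_integral m k)"
    by (rule sum_mono)
  moreover have "?h * dickman (node m n) \<le> integral {node m n - ?h..node m n} dickman"
    using integral_dickman_ge_const[of "node m n - ?h" "node m n"] h cell_radius_le_node[of m n] by simp
  ultimately have "2 * ?h * (\<Sum>k=n-m..<n. dickman (node m k)) \<le> 2 * ?h * (real n * dickman (node m n))"
    using dickman_node_eq[of m n] assms by (simp add: sum_distrib_left)
  then show ?thesis using h by simp
qed

text \<open>The difference of two consecutive recurrences, a discrete form of the delay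
  equation.\<close>

lemma friable_prob_Suc:
  assumes "m \<le> n"
  shows "real (Suc n) * friable_prob (Suc n) m
    = real (Suc n) * friable_prob n m - friable_prob (n - m) m"
proof (cases "n = 0")
  case True
  then show ?thesis using assms friable_prob_rec[of 1 m] by (simp add: friable_prob_0)
next
  case False
  have "real (Suc n) * friable_prob (Suc n) m = (\<Sum>k=Suc n - m..<Suc n. friable_prob k m)"
    using friable_prob_rec[of "Suc n" m] assms by (simp add: min_absorb1)
  moreover have "real n * friable_prob n m = (\<Sum>k=n - m..<n. friable_prob k m)"
    using friable_prob_rec[of n m] assms False by (simp add: min_absorb1)
  moreover have "(\<Sum>k=n - m..<Suc n. friable_prob k m)
      = friable_prob (n - m) m + (\<Sum>k=Suc n - m..<Suc n. friable_prob k m)"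
    using assms unfolding Suc_diff_le[OF assms] by (intro sum.atLeast_Suc_lessThan) simp
  moreover have "(\<Sum>k=n - m..<Suc n. friable_prob k m)
      = (\<Sum>k=n - m..<n. friable_prob k m) + friable_prob n m" by simp
  ultimately show ?thesis by (simp add: algebra_simps)
qed

text \<open>In this range windows reach below \<open>1\<close>, where convexity fails, so increments
  are compared instead. The probability drops by exactly \<open>1 / (n + 1)\<close> and the node
  value by at most \<open>1 / n\<close>; the differences telescope to the error term.\<close>

lemma friable_prob_le_initial:
  assumes "1 \<le> m" "m \<le> n" "n \<le> 2 * m"
  shows "friable_prob n m \<le> dickman (node m n) + 1 / real m - 1 / real n"
  using assms(2,3)
proof (induction n rule: dec_induct)
  case base
  then show ?case by (simp add: friable_prob_eq_1 dickman_node_le)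
next
  case (step n)
  have n: "real n > 0" using step assms by simp
  have x: "node m n \<ge> 1" using node_mono[of m n m] step by (simp add: node_self)
  have "friable_prob (n - m) m = 1" using step by (intro friable_prob_eq_1) simp
  then have "real (Suc n) * friable_prob (Suc n) m = real (Suc n) * (friable_prob n m - 1 / real (Suc n))"
    using friable_prob_Suc[of m n] step by (simp add: right_diff_distrib del: of_nat_Suc)
  then have p: "friable_prob (Suc n) m = friable_prob n m - 1 / real (Suc n)"
    by (simp del: of_nat_Suc)
  have "dickman_rate (node m n) * dickman (node m n) = dickman (node m n - 1) / node m n"
    using dickman_shift_eq_rate[of "node m n"] x by simp
  also have "\<dots> \<le> 1 / node m n" using x dickman_le_1 by (intro divide_right_mono) auto
  finally have "dickman_rate (node m n) * dickman (node m n) * (2 * cell_radius m)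
      \<le> 1 / node m n * (2 * cell_radius m)"
    using cell_radius_pos[of m] by (intro mult_right_mono) auto
  also have "\<dots> = 2 / (2 * real n + 1)"
  proof -
    have "1 / (a / b) * (2 * (1 / b)) = 2 / a" if "b \<noteq> 0" for a b :: real
      using that by simp
    moreover have "2 * real m + 1 \<noteq> 0" by linarith
    ultimately show ?thesis unfolding node_def cell_radius_def by blast
  qed
  also have "\<dots> \<le> 1 / real n" using n by (simp add: field_simps)
  finally have "dickman_rate (node m n) * dickman (node m n) * (2 * cell_radius m) \<le> 1 / real n" .
  moreover have "node m (Suc n) - node m n = 2 * cell_radius m"
    using node_minus[of m "Suc n"] node_plus[of m n] by simp
  then have "dickman (node m n) - dickman_rate (node m n) * dickman (node m n) * (2 * cell_radius m)
      \<le> dickman (node m (Suc n))"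
    using dickman_ge_tangent[of "node m n" "node m (Suc n)"] x node_mono[of n "Suc n" m] by simp
  ultimately show ?case using step p by simp
qed

text \<open>Up to \<open>2 * m\<close> node values are at least \<open>dickman 2\<close>, which
  turns the additive error \<open>1 / m\<close> into a relative one. Beyond that the supersolution
  property carries the factor along unchanged.\<close>

lemma friable_prob_le_dickman:
  assumes "1 \<le> m"
  shows "friable_prob n m \<le> dickman (node m n) * (1 + 1 / (dickman 2 * real m))"
proof (induction n rule: less_induct)
  case (less n)
  define c where "c = 1 / (dickman 2 * real m)"
  have d2: "dickman 2 > 0" by (simp add: dickman_pos)
  have c: "c \<ge> 0" using d2 by (simp add: c_def)
  consider "n < m" | "m \<le> n" "n \<le> 2 * m" | "2 * m < n" by linarith
  then have "friable_prob n m \<le> dickman (node m n) * (1 + c)"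
  proof cases
    case 1
    then show ?thesis using c by (simp add: friable_prob_eq_1 dickman_node_le)
  next
    case 2
    have "node m n \<le> 2" using 2 by (simp add: node_def field_simps)
    then have "dickman 2 \<le> dickman (node m n)"
      using node_pos[of m n] by (intro dickman_antimono) auto
    then have "dickman 2 * c \<le> dickman (node m n) * c" using c by (rule mult_right_mono)
    then have "1 / real m \<le> dickman (node m n) * c" using d2 by (simp add: c_def)
    then show ?thesis using friable_prob_le_initial[OF assms 2]
      by (simp add: algebra_simps) (smt (verit) divide_nonneg_nonneg of_nat_0_le_iff)
  next
    case 3
    have "real n * friable_prob n m = (\<Sum>k=n-m..<n. friable_prob k m)"
      using friable_prob_rec[of n m] 3 by (simp add: min_absorb1)
    also have "\<dots> \<le> (\<Sum>k=n-m..<n. dickman (node m k) * (1 + c))"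
      using less by (intro sum_mono) (auto simp: c_def)
    also have "\<dots> = (\<Sum>k=n-m..<n. dickman (node m k)) * (1 + c)" by (simp add: sum_distrib_right)
    also have "\<dots> \<le> real n * dickman (node m n) * (1 + c)"
      using c sum_dickman_node_le[OF 3] by (intro mult_right_mono) auto
    finally show ?thesis using 3 by (simp add: mult.assoc)
  qed
  then show ?case by (simp add: c_def)
qed

lemma one_minus_ge_exp:
  fixes t :: real assumes "0 \<le> t" "t \<le> 1 / 2"
  shows "exp (- 2 * t) \<le> 1 - t"
proof -
  have "2 * t * t \<le> 1 * t" using assms by (intro mult_right_mono) auto
  then have "- 2 * t \<le> - t - 2 * t\<^sup>2" by (simp add: power2_eq_square)
  also have "\<dots> \<le> ln (1 - t)" using ln_one_minus_pos_lower_bound assms by simp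
  finally show ?thesis using assms by (simp add: ln_ge_iff)
qed

text \<open>The first-order excess of the half cell, relative to the whole window, becomes second
  order: \<open>exp z \<le> x + 1\<close> by the logarithmic bound on the rate, so
  \<open>exp z - 1 \<le> 3 * z * (x - h)\<close>, and the remaining \<open>h\<close> is at most
  \<open>z\<close> because the rate is at least \<open>1\<close>.\<close>

lemma half_cell_defect:
  assumes "1 \<le> x" "0 < h" "h \<le> 1 / 3"
  defines "z \<equiv> dickman_rate x * h"
  shows "exp (- 6 * z\<^sup>2) \<le> 1 - (exp z - 1) * h / (x - h)"
proof -
  define c where "c = dickman_rate x"
  have c: "1 \<le> c" "c \<le> 2 * ln (x + 1)"
    using assms dickman_rate_ge_1 dickman_rate_le by (auto simp: c_def)
  have z: "z = c * h" "h \<le> z" using c assms by (auto simp: z_def c_def)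
  have "c * h \<le> c * (1 / 3)" using c assms by (intro mult_left_mono) auto
  also have "\<dots> \<le> ln (x + 1)" using c by simp
  finally have "exp z \<le> exp (ln (x + 1))" unfolding z by simp
  then have ez: "exp z \<le> x + 1" using assms by simp
  define t where "t = (exp z - 1) * h / (x - h)"
  have xh: "x - h > 0" using assms by simp
  have t0: "t \<ge> 0" using xh z assms by (simp add: t_def)
  have "(exp z - 1) * h \<le> x * h" using ez assms by (intro mult_right_mono) auto
  also have "x * h \<le> x * (1 / 3)" using assms by (intro mult_left_mono) auto
  also have "\<dots> \<le> (x - h) / 2" using assms(1-3) by simp
  finally have t1: "t \<le> 1 / 2" using xh by (simp add: t_def field_simps)
  have "(1 - z) * exp z \<le> exp (- z) * exp z"
    using exp_ge_add_one_self[of "- z"] by (intro mult_right_mono) auto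
  then have "exp z - 1 \<le> z * exp z" by (simp add: exp_minus algebra_simps)
  also have "\<dots> \<le> z * (x + 1)" using ez z assms by (intro mult_left_mono) auto
  also have "\<dots> \<le> z * (3 * (x - h))" using z assms by (intro mult_left_mono) auto
  finally have "(exp z - 1) * h \<le> z * (3 * (x - h)) * z"
    using z assms xh by (intro mult_mono) auto
  then have "t \<le> 3 * z\<^sup>2" using xh by (simp add: t_def power2_eq_square field_simps)
  then have "exp (- 6 * z\<^sup>2) \<le> exp (- 2 * t)" by simp
  also have "\<dots> \<le> 1 - t" by (rule one_minus_ge_exp[OF t0 t1])
  finally show ?thesis by (simp add: t_def)
qed

text \<open>The node values are nearly a subsolution. Cells cost \<open>exp (z^2 / 2)\<close>, as
  the rate at node \<open>n\<close> dominates the earlier ones, and the half cell costs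
  \<open>exp (6 * z^2)\<close>; the exponent \<open>1/2 + 6\<close> is rounded up to
  \<open>7\<close>.\<close>

lemma dickman_node_le_sum:
  assumes "1 \<le> m" "m < n"
  shows "real n * dickman (node m n) * exp (- 7 * (dickman_rate (node m n) * cell_radius m)\<^sup>2)
    \<le> (\<Sum>k=n-m..<n. dickman (node m k))"
proof -
  let ?h = "cell_radius m"
  define x where "x = node m n"
  define z where "z = dickman_rate x * ?h"
  define S where "S = (\<Sum>k=n-m..<n. dickman (node m k))"
  have h: "0 < ?h" "?h \<le> 1 / 3" using cell_radius_pos cell_radius_le assms by auto
  have x: "1 \<le> x" using node_mono[of m n m] assms by (simp add: x_def node_self)
  have f: "dickman x > 0" using x by (simp add: dickman_pos)
  have "cell_integral m k \<le> 2 * ?h * dickman (node m k) * exp (z\<^sup>2 / 2)" if k: "k \<in> {n-m..<n}" for k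
  proof (cases "k \<le> m")
    case True
    have "cell_integral m k \<le> 2 * ?h"
      unfolding cell_integral_def
      using integral_dickman_le_length[of "node m k - ?h" "node m k + ?h"] h cell_radius_le_node[of m k] by simp
    also have "\<dots> \<le> 2 * ?h * exp (z\<^sup>2 / 2)" using h by simp
    finally show ?thesis using True by (simp add: dickman_node_le)
  next
    case False
    then have k1: "1 \<le> node m k" using node_mono[of m k m] by (simp add: node_self)
    have "cell_integral m k \<le> 2 * ?h * dickman (node m k) * exp ((dickman_rate (node m k) * ?h)\<^sup>2 / 2)"
      unfolding cell_integral_def using k1 h by (intro integral_dickman_cell_le) auto
    also have "\<dots> \<le> 2 * ?h * dickman (node m k) * exp (z\<^sup>2 / 2)"
    proof -
      have "dickman_rate (node m k) \<le> dickman_rate x"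
        using k1 node_mono[of k n m] k by (intro dickman_rate_mono) (auto simp: x_def)
      then have "dickman_rate (node m k) * ?h \<le> z"
        using h by (simp add: z_def)
      moreover have "0 \<le> dickman_rate (node m k) * ?h" using dickman_rate_pos[OF k1] h by simp
      ultimately have "(dickman_rate (node m k) * ?h)\<^sup>2 \<le> z\<^sup>2" by (intro power_mono)
      then show ?thesis using h k1 dickman_pos[of "node m k"] by (intro mult_left_mono) auto
    qed
    finally show ?thesis .
  qed
  then have "(\<Sum>k=n-m..<n. cell_integral m k) \<le> (\<Sum>k=n-m..<n. 2 * ?h * dickman (node m k) * exp (z\<^sup>2 / 2))"
    by (rule sum_mono)
  also have "\<dots> = 2 * ?h * exp (z\<^sup>2 / 2) * S"
    by (simp add: S_def sum_distrib_left mult_ac)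
  finally have cells: "(\<Sum>k=n-m..<n. cell_integral m k) \<le> 2 * ?h * exp (z\<^sup>2 / 2) * S" .
  have half: "integral {x - ?h..x} dickman \<le> ?h * dickman x * exp z"
    using integral_dickman_half_cell_le[of x ?h] x h by (simp add: z_def)
  have n: "2 * ?h * real n = x - ?h" by (simp add: node_minus x_def)
  have eq: "(x - ?h) * dickman x = (\<Sum>k=n-m..<n. cell_integral m k)
      + (integral {x - ?h..x} dickman - ?h * dickman x)"
    using dickman_node_eq[of m n] assms n by (simp add: x_def[symmetric] mult.assoc[symmetric])
  have xh: "x - ?h > 0" using x h by simp
  have "(x - ?h) * dickman x * exp (- 6 * z\<^sup>2)
      \<le> (x - ?h) * dickman x * (1 - (exp z - 1) * ?h / (x - ?h))"
    using half_cell_defect[of x ?h] x h f xh by (intro mult_left_mono) (auto simp: z_def)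
  also have "\<dots> = (x - ?h) * dickman x - ?h * dickman x * exp z + ?h * dickman x"
    using xh by (simp add: field_simps)
  also have "\<dots> \<le> 2 * ?h * exp (z\<^sup>2 / 2) * S" using eq cells half by linarith
  finally have "2 * ?h * (real n * dickman x * exp (- 6 * z\<^sup>2)) \<le> 2 * ?h * (exp (z\<^sup>2 / 2) * S)"
    by (simp only: n[symmetric] mult.assoc)
  then have "real n * dickman x * exp (- 6 * z\<^sup>2) \<le> exp (z\<^sup>2 / 2) * S" using h by simp
  then have "exp (- (z\<^sup>2 / 2)) * (real n * dickman x * exp (- 6 * z\<^sup>2)) \<le> exp (- (z\<^sup>2 / 2)) * (exp (z\<^sup>2 / 2) * S)"
    by (intro mult_left_mono) auto
  moreover have "exp (- (z\<^sup>2 / 2)) * (exp (z\<^sup>2 / 2) * S) = S"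
    by (simp add: exp_minus)
  ultimately have "real n * dickman x * (exp (- (z\<^sup>2 / 2)) * exp (- 6 * z\<^sup>2)) \<le> S"
    by (simp only: mult_ac)
  moreover have "exp (- 7 * z\<^sup>2) \<le> exp (- (z\<^sup>2 / 2)) * exp (- 6 * z\<^sup>2)"
    by (simp add: exp_add[symmetric])
  then have "real n * dickman x * exp (- 7 * z\<^sup>2) \<le> real n * dickman x * (exp (- (z\<^sup>2 / 2)) * exp (- 6 * z\<^sup>2))"
    using f by (intro mult_left_mono) auto
  ultimately show ?thesis by (simp add: x_def z_def S_def)
qed

text \<open>Weighted by the decreasing \<open>g\<close>, the exponent has mean at least \<open>a\<close> (Chebyshev), so Jensen's
  inequality applies in the form of the tangent of the exponential function at \<open>a\<close>.\<close>

lemma sum_antimono_exp_ge: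
  fixes g :: "nat \<Rightarrow> real"
  assumes "m > 0" "a \<ge> 0" and g: "\<And>i j. i \<le> j \<Longrightarrow> j < m \<Longrightarrow> g j \<le> g i" "\<And>i. i < m \<Longrightarrow> g i \<ge> 0"
  shows "exp a * (\<Sum>i<m. g i) \<le> (\<Sum>i<m. g i * exp (2 * a * real (m - i) / real m))"
proof -
  define G where "G = (\<Sum>i<m. g i)"
  have "G \<ge> 0" unfolding G_def using g(2) by (intro sum_nonneg) auto
  have "real m * (\<Sum>k=0..<m. real k * g k) \<le> (\<Sum>k=0..<m. real k) * (\<Sum>k=0..<m. g k)"
    using Chebyshev_sum_upper[of m real g] g(1) by simp
  also have "(\<Sum>k=0..<m. real k) = real m * (real m - 1) / 2"
    by (induction m) (auto simp: field_simps)
  finally have "real m * (2 * (\<Sum>i<m. real i * g i)) \<le> real m * ((real m - 1) * G)"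
    by (simp add: G_def atLeast0LessThan)
  then have cheb: "2 * (\<Sum>i<m. real i * g i) \<le> (real m - 1) * G"
    using \<open>m > 0\<close> by simp
  \<comment> \<open>The plain mean of the exponents \<open>2 * a * (m - i) / m\<close> is
    \<open>a * (m + 1) / m\<close>, hence at least \<open>a\<close>; larger exponents carry larger
    weights.\<close>
  have "(\<Sum>i<m. g i * (exp a * (1 + (2 * a * real (m - i) / real m - a))))
      = exp a * (G + a / real m * (real m * G - 2 * (\<Sum>i<m. real i * g i)))"
  proof -
    have "g i * (exp a * (1 + (2 * a * real (m - i) / real m - a)))
        = exp a * (g i + a / real m * (real m * g i - 2 * (real i * g i)))" if "i < m" for i
      using that by (simp add: of_nat_diff field_simps)
    then have "(\<Sum>i<m. g i * (exp a * (1 + (2 * a * real (m - i) / real m - a))))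
        = (\<Sum>i<m. exp a * (g i + a / real m * (real m * g i - 2 * (real i * g i))))"
      by (intro sum.cong) auto
    then show ?thesis
      unfolding G_def by (simp only: sum_distrib_left[symmetric] sum.distrib sum_subtractf)
  qed
  moreover have "a / real m * (real m * G - 2 * (\<Sum>i<m. real i * g i)) \<ge> 0"
    using cheb assms(2) \<open>G \<ge> 0\<close> by (intro mult_nonneg_nonneg) (auto simp: algebra_simps)
  ultimately have "exp a * G \<le> (\<Sum>i<m. g i * (exp a * (1 + (2 * a * real (m - i) / real m - a))))"
    by simp
  also have "\<dots> \<le> (\<Sum>i<m. g i * exp (2 * a * real (m - i) / real m))"
  proof (intro sum_mono mult_left_mono)
    fix i assume "i \<in> {..<m}"
    have "exp a * (1 + (2 * a * real (m - i) / real m - a)) \<le> exp a * exp (2 * a * real (m - i) / real m - a)"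
      by (intro mult_left_mono) auto
    then show "exp a * (1 + (2 * a * real (m - i) / real m - a)) \<le> exp (2 * a * real (m - i) / real m)"
      by (simp add: exp_add[symmetric])
  qed (use g(2) in auto)
  finally show ?thesis by (simp add: G_def)
qed

text \<open>Each step of the recurrence loses a factor \<open>exp (- a n)\<close>. The allowance
  \<open>e\<close> grows by at least \<open>2 * a n / m\<close> per index, and over a window the
  mean of \<open>(n - k) / m\<close> is at least \<open>1/2\<close>, so the smaller allowance of
  earlier terms pays for the loss. Here \<open>14 = 2 * 7\<close>.\<close>

lemma friable_prob_ge_dickman:
  assumes "1 \<le> m" "m \<le> n"
  shows "dickman (node m n) * exp (- (14 * (real n / real m) * (dickman_rate (node m n) * cell_radius m)\<^sup>2))
    \<le> friable_prob n m"
proof -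
  define a where "a k = 7 * (dickman_rate (node m k) * cell_radius m)\<^sup>2" for k
  define e where "e k = (if k \<le> m then 0 else 2 * (real k / real m) * a k)" for k
  have a0: "a k \<ge> 0" for k by (simp add: a_def)
  have amono: "a k \<le> a l" if "m \<le> k" "k \<le> l" for k l
  proof -
    have k: "1 \<le> node m k" using node_mono[of m k m] that by (simp add: node_self)
    then have "dickman_rate (node m k) \<le> dickman_rate (node m l)"
      using node_mono[of k l m] that by (intro dickman_rate_mono) auto
    then show ?thesis
      unfolding a_def using cell_radius_pos[of m] dickman_rate_pos[OF k]
      by (intro mult_left_mono power_mono mult_right_mono) auto
  qed
  have "dickman (node m n) * exp (- e n) \<le> friable_prob n m" for n
  proof (induction n rule: less_induct)
    case (less n)
    show ?case
    proof (cases "n \<le> m")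
      case True
      then show ?thesis by (simp add: e_def friable_prob_eq_1 dickman_node_le)
    next
      case False
      then have "m < n" by simp
      have en: "e n = 2 * (real n / real m) * a n" using False by (simp add: e_def)
      have ek: "e k \<le> e n - 2 * a n * real (n - k) / real m" if "k < n" for k
      proof -
        have "e k \<le> 2 * (real k / real m) * a n"
          using amono[of k n] a0[of n] that by (auto simp: e_def intro!: divide_right_mono mult_left_mono)
        also have "\<dots> = e n - 2 * a n * real (n - k) / real m"
          using that assms(1) unfolding en by (simp add: of_nat_diff field_simps)
        finally show ?thesis .
      qed
      have "real n * dickman (node m n) * exp (- a n) \<le> (\<Sum>k=n-m..<n. dickman (node m k))"
        using dickman_node_le_sum[OF assms(1) \<open>m < n\<close>] by (simp add: a_def)
      then have "exp (a n) * (real n * dickman (node m n) * exp (- a n))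
          \<le> exp (a n) * (\<Sum>k=n-m..<n. dickman (node m k))"
        by (intro mult_left_mono) auto
      moreover have "exp (a n) * (real n * dickman (node m n) * exp (- a n)) = real n * dickman (node m n)"
        by (simp add: exp_minus)
      moreover have "(\<Sum>k=n-m..<n. dickman (node m k)) = (\<Sum>i<m. dickman (node m (n - m + i)))"
        using \<open>m < n\<close> by (intro sum.reindex_bij_witness[of _ "\<lambda>i. n - m + i" "\<lambda>k. k - (n - m)"]) auto
      ultimately have "real n * dickman (node m n) \<le> exp (a n) * (\<Sum>i<m. dickman (node m (n - m + i)))"
        by simp
      also have "\<dots> \<le> (\<Sum>i<m. dickman (node m (n - m + i)) * exp (2 * a n * real (m - i) / real m))"
        using assms(1) a0 node_pos
        by (intro sum_antimono_exp_ge dickman_antimono node_mono)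
          (auto intro!: less_imp_le[OF dickman_pos] less_imp_le[OF node_pos])
      also have "\<dots> = (\<Sum>k=n-m..<n. dickman (node m k) * exp (2 * a n * real (n - k) / real m))"
        using \<open>m < n\<close>
        by (intro sum.reindex_bij_witness[of _ "\<lambda>k. k - (n - m)" "\<lambda>i. n - m + i"]) auto
      finally have "exp (- e n) * (real n * dickman (node m n))
          \<le> exp (- e n) * (\<Sum>k=n-m..<n. dickman (node m k) * exp (2 * a n * real (n - k) / real m))"
        by (intro mult_left_mono) auto
      also have "\<dots> = (\<Sum>k=n-m..<n. dickman (node m k) * exp (- (e n - 2 * a n * real (n - k) / real m)))"
        by (simp add: sum_distrib_left exp_diff exp_minus field_simps)
      also have "\<dots> \<le> (\<Sum>k=n-m..<n. friable_prob k m)"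
      proof (rule sum_mono)
        fix k assume k: "k \<in> {n-m..<n}"
        have "dickman (node m k) * exp (- (e n - 2 * a n * real (n - k) / real m))
            \<le> dickman (node m k) * exp (- e k)"
          using ek[of k] k dickman_pos[of "node m k"] node_pos[of m k] by (intro mult_left_mono) auto
        also have "\<dots> \<le> friable_prob k m" using less k by simp
        finally show "dickman (node m k) * exp (- (e n - 2 * a n * real (n - k) / real m)) \<le> friable_prob k m" .
      qed
      also have "\<dots> = real n * friable_prob n m"
        using friable_prob_rec[of n m] \<open>m < n\<close> by (simp add: min_absorb1)
      finally show ?thesis using \<open>m < n\<close> by (simp add: mult_ac)
    qed
  qed
  from this[of n] have "dickman (node m n) * exp (- e n) \<le> friable_prob n m" .
  moreover have "e n \<le> 14 * (real n / real m) * (dickman_rate (node m n) * cell_radius m)\<^sup>2"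
    using a0[of n] by (simp add: e_def a_def)
  then have "dickman (node m n) * exp (- (14 * (real n / real m) * (dickman_rate (node m n) * cell_radius m)\<^sup>2))
      \<le> dickman (node m n) * exp (- e n)"
    using dickman_pos[of "node m n"] node_pos[of m n] by (intro mult_left_mono) auto
  ultimately show ?thesis by linarith
qed

section \<open>Passage from the nodes to \<open>u\<close> and collection of the error terms\<close>

lemma ln_Suc_ge_half:
  fixes u :: real assumes "u \<ge> 1" shows "1 / 2 \<le> ln (u + 1)"
proof -
  have "exp (1 / 2) \<le> (2 :: real)"
    using exp_bound_half[of "1 / 2 :: real"] by simp
  then have "1 / 2 \<le> ln (2 :: real)" by (subst ln_ge_iff) auto
  also have "\<dots> \<le> ln (u + 1)" using assms by simp
  finally show ?thesis .
qed

text \<open>Replacing the node \<open>(n + 1/2) / (m + 1/2)\<close> by \<open>u = n / m\<close> moves the argument by about \<open>u / (2m)\<close>,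
  which produces the factor \<open>exp (u \<xi>(u) / (2m))\<close>.\<close>

lemma ln_dickman_node_bounds:
  assumes "1 \<le> m" "m < n"
  defines "u \<equiv> real n / real m"
  defines "d \<equiv> ln (dickman (node m n)) - ln (dickman u) - u * xi u / (2 * real m)"
  shows "d \<le> 1 / real m"
    and "- (u * xi u / (4 * (real m)\<^sup>2) + xi u / (2 * real m) + u / (real m)\<^sup>2) \<le> d"
proof -
  define x where "x = node m n"
  define M where "M = real m"
  have M: "M \<ge> 1" using assms by (simp add: M_def)
  have n: "real n = u * M" using M by (simp add: u_def M_def)
  have u: "u > 1" using assms by (simp add: u_def)
  have x: "1 \<le> x" using node_mono[of m n m] assms by (simp add: x_def node_self)
  \<comment> \<open>The exact distance from the node to \<open>u\<close>. Its shortfall from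
    \<open>u / (2 * M)\<close>, multiplied by \<open>xi u\<close>, gives the first two error terms
    of the lower bound; the third comes from replacing the rate at \<open>x\<close> by
    \<open>xi u\<close>.\<close>
  define \<delta> where "\<delta> = (u - 1) / (2 * M + 1)"
  have ux: "u - x = \<delta>"
    using M n by (simp add: x_def node_def \<delta>_def M_def[symmetric] field_simps)
  have \<delta>: "0 \<le> \<delta>" "\<delta> \<le> u / (2 * M)"
    using M u by (auto simp: \<delta>_def intro!: frac_le)
  have xi: "xi u \<ge> 0" using u xi_nonneg by simp
  have T1: "dickman_rate x * \<delta> \<le> ln (dickman x) - ln (dickman u)"
    and T2: "ln (dickman x) - ln (dickman u) \<le> dickman_rate u * \<delta>"
    using ln_dickman_diff_bounds[of x u] x ux \<delta> by auto
  \<comment> \<open>The rate exceeds \<open>xi u\<close> by at most \<open>2 / u\<close>, which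
    times \<open>u / (2 * M)\<close> is the error \<open>1 / M\<close>.\<close>
  have "ln ((u + 1) / u) \<le> (u + 1) / u - 1" using u by (intro ln_le_minus_one) simp
  also have "\<dots> = 1 / u" using u by (simp add: field_simps)
  finally have "dickman_rate u \<le> xi u + 2 / u" using dickman_rate_le_xi[OF u] by simp
  then have "dickman_rate u * \<delta> \<le> (xi u + 2 / u) * (u / (2 * M))"
    using \<delta> u xi M by (intro mult_mono) auto
  also have "\<dots> = u * xi u / (2 * M) + 1 / M"
    using u M by (simp add: field_simps)
  finally show "d \<le> 1 / real m" using T2 by (simp add: d_def x_def M_def)
  have "2 * u / 3 \<le> x"
  proof -
    have "2 * u / 3 = 2 * real n / (3 * M)" using M n by simp
    also have "\<dots> \<le> (2 * real n + 1) / (2 * M + 1)" using M by (intro frac_le) auto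
    finally show ?thesis by (simp add: x_def node_def M_def)
  qed
  then have "\<delta> / x \<le> u / (2 * M) / (2 * u / 3)"
    using \<delta> u by (intro frac_le) auto
  also have "\<dots> \<le> 1 / M" using u M by (simp add: field_simps)
  finally have \<delta>x: "\<delta> / x \<le> 1 / M" .
  have "ln (u / x) \<le> u / x - 1" using x u by (intro ln_le_minus_one) auto
  also have "\<dots> = \<delta> / x" using x ux by (simp add: field_simps)
  finally have "xi u - 2 / M \<le> dickman_rate x"
    using xi_le_dickman_rate[of x u] x ux \<delta> \<delta>x by simp
  then have "(xi u - 2 / M) * \<delta> \<le> dickman_rate x * \<delta>" using \<delta> by (intro mult_right_mono) auto
  moreover have "2 / M * \<delta> \<le> u / M\<^sup>2"
    using mult_left_mono[OF \<delta>(2), of "2 / M"] M by (simp add: power2_eq_square)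
  moreover have "xi u * (u / (2 * M) - \<delta>) \<le> xi u * (u / (4 * M\<^sup>2) + 1 / (2 * M))"
  proof (rule mult_left_mono[OF _ xi])
    have "a / b - (a - 1) / c = a * (c - b) / (b * c) + 1 / c" if "b > 0" "c > 0" for a b c :: real
      using that by (simp add: field_simps)
    from this[of "2 * M" "2 * M + 1" u]
    have "u / (2 * M) - \<delta> = u / (2 * M * (2 * M + 1)) + 1 / (2 * M + 1)"
      using M by (simp add: \<delta>_def)
    also have "\<dots> \<le> u / (4 * M\<^sup>2) + 1 / (2 * M)"
      using M u by (intro add_mono frac_le) (auto simp: power2_eq_square)
    finally show "u / (2 * M) - \<delta> \<le> u / (4 * M\<^sup>2) + 1 / (2 * M)" .
  qed
  ultimately show "- (u * xi u / (4 * (real m)\<^sup>2) + xi u / (2 * real m) + u / (real m)\<^sup>2) \<le> d"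
    using T1 unfolding d_def x_def M_def by (simp add: algebra_simps)
qed

text \<open>A common source of both claims: the comparison at the nodes combined with the change of
  argument.\<close>

lemma friable_prob_ln_bound:
  obtains C where "C > 0" "\<And>n m. 1 \<le> m \<Longrightarrow> m \<le> n \<Longrightarrow>
    \<bar>ln (friable_prob n m / (dickman (real n / real m) *
        exp (real n / real m * xi (real n / real m) / (2 * real m))))\<bar>
    \<le> C * (real n / real m * (ln (real n / real m + 1))\<^sup>2 / (real m)\<^sup>2 + ln (real n / real m + 1) / real m)"
proof
  define c where "c = 1 / dickman 2"
  have c: "c > 0" by (simp add: c_def dickman_pos)
  \<comment> \<open>From above the error is \<open>(2 * c + 2) * Q\<close>, from below
    \<open>(14 + 5) * P + Q\<close>; the constant covers both.\<close>
  show "2 * c + 24 > 0" using c by simp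
  fix n m :: nat assume mn: "1 \<le> m" "m \<le> n"
  define u where "u = real n / real m"
  define M where "M = real m"
  define L where "L = ln (u + 1)"
  define x where "x = node m n"
  define P where "P = u * L\<^sup>2 / M\<^sup>2"
  define Q where "Q = L / M"
  define d where "d = ln (dickman x) - ln (dickman u) - u * xi u / (2 * M)"
  have M: "M \<ge> 1" using mn by (simp add: M_def)
  have u: "u \<ge> 1" using mn by (simp add: u_def)
  have L: "L \<ge> 1 / 2" using ln_Suc_ge_half[OF u] by (simp add: L_def)
  have x: "1 \<le> x" using node_mono[of m n m] mn by (simp add: x_def node_self)
  have fx: "dickman x > 0" and fu: "dickman u > 0" using x u by (auto simp: dickman_pos)
  have p: "friable_prob n m > 0" using mn by (simp add: friable_prob_pos)
  have P0: "P \<ge> 0" and Q0: "Q \<ge> 0" using u L M by (auto simp: P_def Q_def)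
  \<comment> \<open>Since \<open>L\<close> is bounded away from \<open>0\<close>, terms without a
    logarithm are absorbed into \<open>Q\<close> here and into \<open>P\<close> through
    \<open>sq\<close>.\<close>
  have Q1: "1 / M \<le> 2 * Q" using L M by (simp add: Q_def field_simps)
  have sq: "1 \<le> 4 * L\<^sup>2" "L \<le> 2 * L\<^sup>2"
    using mult_mono[of "1/2" L "1/2" L] mult_right_mono[of "1/2" L L] L by (auto simp: power2_eq_square)
  have xi: "0 \<le> xi u" "xi u \<le> 2 * L"
  proof -
    have "ln u \<le> L" using u by (simp add: L_def)
    then show "xi u \<le> 2 * L" using xi_le[OF u] by simp
  qed (use u xi_nonneg in simp)
  have d: "d \<le> 2 * Q" "- (5 * P + Q) \<le> d"
  proof -
    have "d \<le> 2 * Q \<and> - (5 * P + Q) \<le> d"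
    proof (cases "m = n")
      \<comment> \<open>For \<open>m = n\<close> both arguments of \<open>dickman\<close> are
        \<open>1\<close> and \<open>xi 1 = 0\<close>, so \<open>d\<close> vanishes.\<close>
      case True
      then have "u = 1" "x = 1" using mn by (auto simp: u_def x_def node_self)
      then show ?thesis using P0 Q0 by (simp add: d_def xi_def)
    next
      case False
      then have "m < n" using mn by simp
      note b = ln_dickman_node_bounds[OF mn(1) this, folded u_def M_def x_def, folded d_def]
      have h1: "u * xi u / (4 * M\<^sup>2) \<le> u * (4 * L\<^sup>2) / (4 * M\<^sup>2)"
        using u xi sq M by (intro divide_right_mono mult_left_mono) auto
      have h2: "u / M\<^sup>2 \<le> u * (4 * L\<^sup>2) / M\<^sup>2"
        using mult_left_mono[OF sq(1), of u] u by (intro divide_right_mono) auto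
      have h3: "xi u / (2 * M) \<le> 2 * L / (2 * M)"
        using xi M by (intro divide_right_mono) auto
      have "u * xi u / (4 * M\<^sup>2) + xi u / (2 * M) + u / M\<^sup>2 \<le> 5 * P + Q"
      proof -
        have "u * (4 * L\<^sup>2) / (4 * M\<^sup>2) = P" "u * (4 * L\<^sup>2) / M\<^sup>2 = 4 * P" "2 * L / (2 * M) = Q"
          by (simp_all add: P_def Q_def)
        then show ?thesis using h1 h2 h3 by linarith
      qed
      then show ?thesis using b Q1 by linarith
    qed
    then show "d \<le> 2 * Q" "- (5 * P + Q) \<le> d" by auto
  qed
  have "ln (friable_prob n m) \<le> ln (dickman x * (1 + c / M))"
    using friable_prob_le_dickman[OF mn(1), of n] p by (intro ln_mono) (auto simp: x_def c_def M_def)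
  also have "\<dots> = ln (dickman x) + ln (1 + c / M)"
  proof -
    have "1 + c / M > 0" using c M by (simp add: add_pos_nonneg)
    then show ?thesis using fx by (simp add: ln_mult)
  qed
  also have "ln (1 + c / M) \<le> c * (1 / M)" using c M ln_add_one_self_le_self[of "c / M"] by simp
  also have "\<dots> \<le> c * (2 * Q)" using c Q1 by (intro mult_left_mono) auto
  finally have up: "ln (friable_prob n m) \<le> ln (dickman x) + 2 * c * Q" by simp
  have "ln (dickman x * exp (- (14 * u * (dickman_rate x * cell_radius m)\<^sup>2))) \<le> ln (friable_prob n m)"
    using friable_prob_ge_dickman[OF mn] fx by (intro ln_mono) (auto simp: x_def u_def)
  then have low: "ln (dickman x) - 14 * u * (dickman_rate x * cell_radius m)\<^sup>2 \<le> ln (friable_prob n m)"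
    using fx by (simp add: ln_mult)
  have "x \<le> u"
    using mn by (simp add: x_def node_def u_def field_simps)
  then have "ln (x + 1) \<le> L" using x by (simp add: L_def)
  then have "dickman_rate x \<le> 2 * L" using dickman_rate_le[OF x] by linarith
  moreover have "cell_radius m \<le> 1 / (2 * M)"
    using M by (simp add: cell_radius_def M_def[symmetric] frac_le)
  ultimately have "dickman_rate x * cell_radius m \<le> 2 * L * (1 / (2 * M))"
    using L cell_radius_pos[of m] by (intro mult_mono) auto
  then have "(dickman_rate x * cell_radius m)\<^sup>2 \<le> (L / M)\<^sup>2"
    using dickman_rate_pos[OF x] cell_radius_pos[of m] by (intro power_mono) auto
  then have "u * (dickman_rate x * cell_radius m)\<^sup>2 \<le> u * (L / M)\<^sup>2"
    using u by (intro mult_left_mono) auto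
  then have "u * (dickman_rate x * cell_radius m)\<^sup>2 \<le> P" by (simp add: P_def power_divide)
  then have low: "ln (dickman x) - 14 * P \<le> ln (friable_prob n m)" using low by simp
  have "ln (friable_prob n m / (dickman u * exp (u * xi u / (2 * M))))
      = ln (friable_prob n m) - ln (dickman x) + d"
    using p fu by (simp add: d_def ln_div ln_mult)
  moreover have "\<bar>ln (friable_prob n m) - ln (dickman x) + d\<bar> \<le> (2 * c + 24) * (P + Q)"
  proof -
    have "c * P \<ge> 0" "c * Q \<ge> 0" using c P0 Q0 by auto
    then have "2 * c * Q + 2 * Q \<le> (2 * c + 24) * (P + Q)" "14 * P + (5 * P + Q) \<le> (2 * c + 24) * (P + Q)"
      using P0 Q0 by (simp_all add: algebra_simps)
    then show ?thesis using up low d by linarith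
  qed
  ultimately show "\<bar>ln (friable_prob n m / (dickman (real n / real m) *
        exp (real n / real m * xi (real n / real m) / (2 * real m))))\<bar>
    \<le> (2 * c + 24) * (real n / real m * (ln (real n / real m + 1))\<^sup>2 / (real m)\<^sup>2 + ln (real n / real m + 1) / real m)"
    by (simp add: u_def M_def P_def Q_def L_def)
qed

section \<open>Deduction of the two claims\<close>

lemma abs_exp_minus_one_le:
  fixes x :: real shows "\<bar>exp x - 1\<bar> \<le> \<bar>x\<bar> * exp \<bar>x\<bar>"
proof (cases "x \<ge> 0")
  case True
  have "(1 - x) * exp x \<le> exp (- x) * exp x"
    using exp_ge_add_one_self[of "- x"] by (intro mult_right_mono) auto
  then show ?thesis using True by (simp add: exp_minus algebra_simps)
next
  case False
  have "1 - exp x \<le> - x" using exp_ge_add_one_self[of x] by linarith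
  also have "\<dots> \<le> - x * exp (- x)" using False mult_left_mono[of 1 "exp (- x)" "- x"] by simp
  finally show ?thesis using False by simp
qed

text \<open>With \<open>q = ln (u + 1) / m\<close> this trades the error \<open>q\<close> for the
  two errors allowed in the first claim.\<close>

lemma am_gm_reciprocal:
  fixes u q :: real assumes "u > 0"
  shows "u * q\<^sup>2 + q \<le> 2 * (u * q\<^sup>2 + 1 / u)"
proof -
  have "0 \<le> u * (q - 1 / u)\<^sup>2" using assms by simp
  also have "\<dots> = u * q\<^sup>2 - 2 * q + 1 / u"
    using assms by (simp add: power2_eq_square field_simps)
  finally have "2 * q \<le> u * q\<^sup>2 + 1 / u" by simp
  moreover have "0 \<le> u * q\<^sup>2" "0 \<le> 1 / u" using assms by auto
  ultimately show ?thesis by argo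
qed

theorem theorem1p1:
  shows "(\<exists>C>0. \<forall>n m :: nat. 1 \<le> m \<and> m \<le> n \<longrightarrow>
            (let u = real n / real m in
              \<bar>ln (friable_prob n m / (dickman u * exp (u * xi u / (2 * real m))))\<bar>
                \<le> C * (u * (ln (u + 1))\<^sup>2 / (real m)\<^sup>2 + 1 / u)))
       \<and> (\<forall>K>0. \<exists>C>0. \<forall>n m :: nat.
            1 \<le> m \<and> m \<le> n \<and> sqrt (real n * ln (real n)) \<le> K * real m \<longrightarrow>
            (let u = real n / real m in
              \<exists>\<theta>. friable_prob n m = dickman u * exp (u * xi u / (2 * real m)) * (1 + \<theta>)
                  \<and> \<bar>\<theta>\<bar> \<le> C * (ln (u + 1) / real m)))"
proof -
  obtain C where C: "C > 0" and bound: "\<And>n m. 1 \<le> m \<Longrightarrow> m \<le> n \<Longrightarrow>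
    \<bar>ln (friable_prob n m / (dickman (real n / real m) *
        exp (real n / real m * xi (real n / real m) / (2 * real m))))\<bar>
    \<le> C * (real n / real m * (ln (real n / real m + 1))\<^sup>2 / (real m)\<^sup>2 + ln (real n / real m + 1) / real m)"
    using friable_prob_ln_bound by blast
  have "\<bar>ln (friable_prob n m / (dickman u * exp (u * xi u / (2 * real m))))\<bar>
      \<le> 2 * C * (u * (ln (u + 1))\<^sup>2 / (real m)\<^sup>2 + 1 / u)"
    if mn: "1 \<le> m" "m \<le> n" and u: "u = real n / real m" for n m u
  proof -
    define L where "L = ln (u + 1)"
    define P where "P = u * L\<^sup>2 / (real m)\<^sup>2"
    have u1: "u \<ge> 1" using mn by (simp add: u)
    have "P = u * (L / real m)\<^sup>2" by (simp add: P_def power_divide)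
    then have "P + L / real m \<le> 2 * (P + 1 / u)"
      using am_gm_reciprocal[of u "L / real m"] u1 by simp
    then have "C * (P + L / real m) \<le> C * (2 * (P + 1 / u))" using C by (intro mult_left_mono) auto
    also have "\<dots> = 2 * C * (P + 1 / u)" by simp
    finally show ?thesis
      unfolding L_def[symmetric] P_def[symmetric]
      by (rule order_trans[OF bound[OF mn, folded u, folded L_def, folded P_def]])
  qed
  then have part1: "\<exists>C>0. \<forall>n m :: nat. 1 \<le> m \<and> m \<le> n \<longrightarrow>
            (let u = real n / real m in
              \<bar>ln (friable_prob n m / (dickman u * exp (u * xi u / (2 * real m))))\<bar>
                \<le> C * (u * (ln (u + 1))\<^sup>2 / (real m)\<^sup>2 + 1 / u))"
    using C by (intro exI[of _ "2 * C"]) (simp add: Let_def)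
  have part2: "\<exists>C>0. \<forall>n m :: nat.
            1 \<le> m \<and> m \<le> n \<and> sqrt (real n * ln (real n)) \<le> K * real m \<longrightarrow>
            (let u = real n / real m in
              \<exists>\<theta>. friable_prob n m = dickman u * exp (u * xi u / (2 * real m)) * (1 + \<theta>)
                  \<and> \<bar>\<theta>\<bar> \<le> C * (ln (u + 1) / real m))" if "K > 0" for K
  proof -
    \<comment> \<open>Chosen so that \<open>u * L \<le> B * m\<close>. For \<open>n \<ge> 2\<close>,
      \<open>L \<le> 2 * ln n\<close> and the hypothesis give \<open>2 * K^2\<close>; the extra
      \<open>1\<close> covers \<open>n = 1\<close>, where \<open>ln n = 0\<close> but
      \<open>L = ln 2\<close>.\<close>
    define B where "B = 2 * K\<^sup>2 + 1"
    define A where "A = C * (B + 1)"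
    have B: "B \<ge> 1" by (simp add: B_def)
    have A: "A > 0" using C B by (simp add: A_def)
    have "\<exists>\<theta>. friable_prob n m = dickman u * exp (u * xi u / (2 * real m)) * (1 + \<theta>)
                  \<and> \<bar>\<theta>\<bar> \<le> A * exp (A * B) * (ln (u + 1) / real m)"
      if mn: "1 \<le> m" "m \<le> n" and K: "sqrt (real n * ln (real n)) \<le> K * real m"
        and u: "u = real n / real m" for n m u
    proof -
      define L where "L = ln (u + 1)"
      have u1: "u \<ge> 1" using mn by (simp add: u)
      have L: "L > 0" using u1 by (simp add: L_def)
      have m: "real m \<ge> 1" using mn by simp
      have uL: "u * L \<le> B * real m"
      proof (cases "n = 1")
        case True
        then have "m = 1" using mn by simp
        then have "u * L = ln 2" using True by (simp add: u L_def)
        also have "\<dots> \<le> 1" using ln_le_minus_one[of "2::real"] by simp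
        also have "\<dots> \<le> B * real m" using B m by (simp add: \<open>m = 1\<close>)
        finally show ?thesis .
      next
        case False
        then have n: "real n \<ge> 2" using mn by simp
        have "u \<le> real n" using frac_le[of "real n" "real n" 1 "real m"] m by (simp add: u)
        moreover have "real n + 1 \<le> real n * real n"
          using mult_right_mono[OF n, of "real n"] n by linarith
        ultimately have "L \<le> ln (real n * real n)"
          using u1 unfolding L_def by (intro ln_mono) auto
        then have "L \<le> 2 * ln (real n)" using n by (simp add: ln_mult)
        then have "u * L \<le> u * (2 * ln (real n))" using u1 by (intro mult_left_mono) auto
        also have "\<dots> = 2 * (real n * ln (real n)) / real m" by (simp add: u)
        also have "\<dots> \<le> 2 * (K * real m)\<^sup>2 / real m"
          using K by (intro divide_right_mono mult_left_mono sqrt_le_D) auto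
        also have "\<dots> = 2 * K\<^sup>2 * real m" using m by (simp add: power2_eq_square)
        also have "\<dots> \<le> B * real m" by (intro mult_right_mono) (auto simp: B_def)
        finally show ?thesis .
      qed
      have "1 * L \<le> u * L" using u1 L by (intro mult_right_mono) auto
      then have Lm: "L / real m \<le> B" using uL m by (simp add: field_simps)
      define d where "d = ln (friable_prob n m / (dickman u * exp (u * xi u / (2 * real m))))"
      have pos: "friable_prob n m > 0" "dickman u * exp (u * xi u / (2 * real m)) > 0"
        using mn u1 by (auto simp: friable_prob_pos dickman_pos)
      \<comment> \<open>The range of \<open>m\<close> makes the first error term at most
        \<open>B\<close> times the second.\<close>
      have "u * L\<^sup>2 / (real m)\<^sup>2 = (u * L) / real m * (L / real m)" by (simp add: power2_eq_square)
      also have "\<dots> \<le> B * (L / real m)" using uL L m by (intro mult_right_mono) (auto simp: field_simps)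
      finally have "u * L\<^sup>2 / (real m)\<^sup>2 + L / real m \<le> (B + 1) * (L / real m)"
        by (simp only: distrib_right mult_1_left add_le_cancel_right)
      then have "C * (u * L\<^sup>2 / (real m)\<^sup>2 + L / real m) \<le> C * ((B + 1) * (L / real m))"
        using C by (intro mult_left_mono) auto
      then have d: "\<bar>d\<bar> \<le> A * (L / real m)"
        using bound[OF mn, folded u, folded L_def, folded d_def] by (simp add: A_def mult.assoc)
      also have "\<dots> \<le> A * B" using A Lm by (intro mult_left_mono) auto
      finally have dB: "\<bar>d\<bar> \<le> A * B" .
      \<comment> \<open>The witness for \<theta> is \<open>exp d - 1\<close>; it is linear in
        \<open>d\<close> up to the factor \<open>exp (A * B)\<close> because \<open>d\<close> is
        bounded.\<close>
      have "\<bar>exp d - 1\<bar> \<le> \<bar>d\<bar> * exp \<bar>d\<bar>" by (rule abs_exp_minus_one_le)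
      also have "\<dots> \<le> A * (L / real m) * exp (A * B)"
        using d dB A L m by (intro mult_mono) auto
      finally have "\<bar>exp d - 1\<bar> \<le> A * exp (A * B) * (L / real m)" by (simp add: mult_ac)
      moreover have "exp d = friable_prob n m / (dickman u * exp (u * xi u / (2 * real m)))"
        unfolding d_def using pos by (intro exp_ln divide_pos_pos)
      then have "friable_prob n m = dickman u * exp (u * xi u / (2 * real m)) * (1 + (exp d - 1))"
        using u1 dickman_pos[of u] by auto
      ultimately show ?thesis unfolding L_def by blast
    qed
    then show ?thesis
      using A by (intro exI[of _ "A * exp (A * B)"]) (simp add: Let_def)
  qed
  show ?thesis using part1 part2 by blast
qed

end
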